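(* Let $\alpha,\beta,\gamma>0$ be real numbers and let $F^{(\gamma)}_{\alpha,\beta}(z)=\sum_{n\ge 0}\frac{z^n}{(\Gamma(\beta+\alpha n))^\gamma}$, $z\in\mathbb{C}$. Then the following hold. (a) If $\gamma\le 1$, the function $x\mapsto F^{(\gamma)}_{\alpha,\beta}(-x)$ is completely monotone on $(0,\infty)$ if and only if $\alpha\gamma\le 1$ and $\beta\ge\alpha$. (b) If $\gamma>1$ and $\alpha\gamma\neq 1$, the function $x\mapsto F^{(\gamma)}_{\alpha,\beta}(-x)$ is completely monotone on $(0,\infty)$ if $\alpha\gamma<1$ and $\beta\ge \alpha(1+\gamma)/2$, and it is not completely monotone on $(0,\infty)$ if $\alpha\gamma>1$ or $\beta\le\alpha$. (c) If $\gamma>1$ and $\alpha\gamma=1$, the function $x\mapsto F^{(\gamma)}_{\alpha,\beta}(-x)$ is completely monotone on $(0,\infty)$ if and only if $\beta\ge(1+\alpha)/2$.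
   Context: $\Gamma$ denotes the Euler Gamma function, and $(\Gamma(\beta+\alpha n))^\gamma$ is the real $\gamma$-th power of the positive number $\Gamma(\beta+\alpha n)$. For all $\alpha,\beta,\gamma>0$ the series defining $F^{(\gamma)}_{\alpha,\beta}$ converges for every $z\in\mathbb{C}$ and defines an entire function (a Mittag-Leffler function of Le Roy type). A function $f:(0,\infty)\to\mathbb{R}$ is completely monotone on $(0,\infty)$ if it is infinitely differentiable and $(-1)^n f^{(n)}(x)\ge 0$ for all integers $n\ge 0$ and all $x>0$. *)

theory Defs
  imports "HOL-Analysis.Analysis"
begin

text \<open>The Mittag-Leffler function of Le Roy type. \<^term>\<open>Gamma\<close> is used at the real arguments
  \<open>\<beta> + \<alpha> n\<close>; for \<open>\<alpha>, \<beta> > 0\<close> its values there are positive, so that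
  \<open>powr\<close> is the genuine real power.\<close>

definition le_roy :: "real \<Rightarrow> real \<Rightarrow> real \<Rightarrow> complex \<Rightarrow> complex" where
  "le_roy \<alpha> \<beta> \<gamma> z =
     (\<Sum>n. z ^ n / complex_of_real (Gamma (\<beta> + \<alpha> * real n) powr \<gamma>))"

text \<open>The function \<open>x \<mapsto> F(-x)\<close> as a real function: at real arguments the series has real terms,
  so \<^term>\<open>Re\<close> only changes the type.\<close>

definition le_roy_neg :: "real \<Rightarrow> real \<Rightarrow> real \<Rightarrow> real \<Rightarrow> real" where
  "le_roy_neg \<alpha> \<beta> \<gamma> x = Re (le_roy \<alpha> \<beta> \<gamma> (complex_of_real (- x)))"

text \<open>Complete monotonicity on \<open>(0, \<infinity>)\<close>. The value of \<^term>\<open>deriv\<close> is meaningful only at points of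
  differentiability, hence the explicit first conjunct. As \<open>(0, \<infinity>)\<close> is open, the iterated
  derivatives at \<open>x > 0\<close> do not depend on the values of \<open>f\<close> outside it.\<close>

definition completely_monotone :: "(real \<Rightarrow> real) \<Rightarrow> bool" where
  "completely_monotone f \<longleftrightarrow>
     (\<forall>n. \<forall>x>0. (deriv ^^ n) f field_differentiable at x) \<and>
     (\<forall>n. \<forall>x>0. (-1) ^ n * (deriv ^^ n) f x \<ge> 0)"

end

theory Submission
  imports Defs "HOL-Real_Asymp.Real_Asymp"
begin

text \<open>Write \<open>F(-x) = \<Sum>n. (-x)^n a n / n!\<close> with \<open>a n = n! / \<Gamma>(\<beta> + \<alpha> n)^\<gamma>\<close>. Differentiation shifts \<open>a\<close>, so
  complete monotonicity says that the alternating generating functions of all shifts of \<open>a\<close> are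
  nonnegative on \<open>(0, \<infinity>)\<close>. The picture behind everything is that \<open>a\<close> should be the moment sequence
  of a positive measure on \<open>[0, \<infinity>)\<close> with Laplace transform \<open>F(-x)\<close>; no measure is ever built.

  Sufficiency. By the Gauss product for \<open>\<Gamma>\<close>, \<open>a n\<close> is a limit of terms
  \<open>c r^n (\<Prod>j. y j + n)^\<gamma> / (\<Prod>i. i + n)\<close> with \<open>y j = (\<beta> + j) / \<alpha>\<close>. Each logarithm is a
  superposition of exponentials, so such a quotient is a Hausdorff moment sequence (up to the factor
  \<open>r^n\<close>) as soon as \<open>\<gamma> (\<Sum>j. exp (-t y j)) \<le> (\<Sum>i. exp (-t i))\<close> for all \<open>t > 0\<close>
  (\<open>hausdorff_prod_ratio\<close>). Summing the geometric series, this is implied by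
  \<open>\<gamma> exp (-t \<beta>/\<alpha>) / (1 - exp (-t/\<alpha>)) \<le> exp (-t) / (1 - exp (-t))\<close>, which is the
  concavity of \<open>1 - exp (-t)\<close> for \<open>\<gamma> \<le> 1\<close> and \<open>\<gamma> sinh (t/2) \<le> sinh (\<gamma> t/2)\<close> for \<open>\<gamma> > 1\<close>.
  Nonnegativity of the generating function passes to pointwise limits of the sequences, because
  for Hausdorff sequences even the truncations of odd length are nonnegative.

  Necessity. Complete monotonicity makes \<open>a\<close> log-convex, so \<open>a (n + 1) / a n\<close> is nondecreasing and
  at most its limit. This ratio behaves like \<open>n / (\<alpha> n)^(\<alpha> \<gamma>)\<close>, which excludes \<open>\<alpha> \<gamma> > 1\<close>; for
  \<open>\<alpha> \<gamma> = 1\<close> the limit is \<open>1 / \<alpha>\<close>, and the second-order behaviour of \<open>\<Gamma>(z + \<alpha>) / \<Gamma>(z)\<close>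
  (\<open>Gamma_ratio_upper_bound\<close>) shows that the ratio exceeds it for large \<open>n\<close> if \<open>\<beta> < (1 + \<alpha>) / 2\<close>.

  The condition relating \<open>\<beta>\<close> to \<open>\<alpha>\<close> comes from the decay at infinity. Averaging \<open>F(-x exp (-t))\<close>
  against \<open>t^(\<gamma> - 1) exp (-t \<beta>/\<alpha>)\<close> multiplies the \<open>n\<close>-th coefficient by a constant times
  \<open>(\<beta> + \<alpha> n)^(-\<gamma>)\<close>, that is, it replaces \<open>\<beta>\<close> by \<open>\<beta> + 1\<close>. If \<open>F(-x)\<close> is nonnegative, the
  functions for \<open>\<beta> + 1, \<beta> + 2, ...\<close> are therefore all bounded below, for large \<open>x\<close>, by a positive
  multiple of \<open>x^(-\<beta>/\<alpha>) (ln x)^(\<gamma> - 1)\<close>. For a large second parameter \<open>B\<close>, however, the function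
  is \<open>O(1/x)\<close>, since \<open>x\<close> times it is \<open>\<Gamma>(B - \<alpha>)^(-\<gamma>)\<close> minus the function for \<open>B - \<alpha>\<close>,
  which is nonnegative by the sufficiency part. This forces \<open>\<beta> > \<alpha>\<close>, or \<open>\<beta> = \<alpha>\<close> and \<open>\<gamma> \<le> 1\<close>.\<close>

section \<open>Complete monotonicity of alternating exponential generating functions\<close>

definition egf_neg :: "(nat \<Rightarrow> real) \<Rightarrow> real \<Rightarrow> real" where
  "egf_neg a x = (\<Sum>n. a n / fact n * (- x) ^ n)"

definition entire_seq :: "(nat \<Rightarrow> real) \<Rightarrow> bool" where
  "entire_seq a \<longleftrightarrow> (\<forall>x. summable (\<lambda>n. a n / fact n * x ^ n))"

lemma entire_seqD: "entire_seq a \<Longrightarrow> summable (\<lambda>n. a n / fact n * x ^ n)"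
  by (simp add: entire_seq_def)

lemma diffs_egf: "diffs (\<lambda>n. a n / fact n) = (\<lambda>n. a (Suc n) / fact n)"
  for a :: "nat \<Rightarrow> real"
  by (rule ext) (simp add: diffs_def divide_simps del: of_nat_Suc)

lemma entire_seq_Suc: "entire_seq a \<Longrightarrow> entire_seq (\<lambda>n. a (Suc n))"
  unfolding entire_seq_def
  using termdiff_converges_all[of "\<lambda>n. a n / fact n"] by (simp add: diffs_egf)

lemma entire_seq_shift: "entire_seq a \<Longrightarrow> entire_seq (\<lambda>n. a (n + k))"
proof (induction k)
  case (Suc k)
  from entire_seq_Suc[OF Suc.IH[OF Suc.prems]] show ?case by simp
qed simp

lemma egf_neg_0 [simp]: "egf_neg a 0 = a 0"
  using powser_zero[of "\<lambda>n. a n / fact n"] by (simp add: egf_neg_def)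

lemma DERIV_egf_neg:
  assumes "entire_seq a"
  shows "(egf_neg a has_real_derivative - egf_neg (\<lambda>n. a (Suc n)) x) (at x)"
proof -
  have "((\<lambda>x. \<Sum>n. a n / fact n * x ^ n) has_real_derivative
          (\<Sum>n. a (Suc n) / fact n * (- x) ^ n)) (at (- x))"
    using termdiffs_strong_converges_everywhere[of "\<lambda>n. a n / fact n" "- x"] assms
    by (simp add: entire_seq_def diffs_egf)
  from DERIV_chain'[OF DERIV_minus[OF DERIV_ident] this] show ?thesis
    by (simp add: egf_neg_def[abs_def])
qed

lemma DERIV_egf_neg_iterated:
  assumes "entire_seq a"
  shows "((\<lambda>x. (-1) ^ k * egf_neg (\<lambda>n. a (n + k)) x) has_real_derivative
           (-1) ^ Suc k * egf_neg (\<lambda>n. a (n + Suc k)) x) (at x)"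
  using DERIV_cmult[OF DERIV_egf_neg[OF entire_seq_shift[OF assms, of k]], of "(-1) ^ k" x]
  by simp

lemma deriv_egf_neg_iterated:
  assumes "entire_seq a"
  shows "(deriv ^^ k) (egf_neg a) = (\<lambda>x. (-1) ^ k * egf_neg (\<lambda>n. a (n + k)) x)"
proof (induction k)
  case (Suc k)
  show ?case
    by (rule ext) (simp only: funpow.simps o_apply Suc.IH
        DERIV_imp_deriv[OF DERIV_egf_neg_iterated[OF assms]])
qed simp

lemma completely_monotone_egf_neg_iff:
  assumes "entire_seq a"
  shows "completely_monotone (egf_neg a) \<longleftrightarrow> (\<forall>k. \<forall>x>0. egf_neg (\<lambda>n. a (n + k)) x \<ge> 0)"
proof -
  have "(deriv ^^ k) (egf_neg a) field_differentiable at x" for k x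
    unfolding deriv_egf_neg_iterated[OF assms]
    using DERIV_egf_neg_iterated[OF assms] by (auto simp: field_differentiable_def)
  moreover have "(-1) ^ k * (deriv ^^ k) (egf_neg a) x = egf_neg (\<lambda>n. a (n + k)) x" for k x
    by (simp add: deriv_egf_neg_iterated[OF assms] flip: mult.assoc power_mult_distrib)
  ultimately show ?thesis
    by (simp add: completely_monotone_def)
qed

section \<open>Hausdorff moment sequences\<close>

text \<open>The negative of the forward difference, so that all its iterates are nonnegative on the moment
  sequences of measures on \<open>[0, 1]\<close>.\<close>

definition decrement :: "(nat \<Rightarrow> real) \<Rightarrow> nat \<Rightarrow> real" where
  "decrement a n = a n - a (Suc n)"

text \<open>By Hausdorff's theorem these are the moment sequences of positive measures on \<open>[0, 1]\<close>; the
  difference conditions have the advantage that they concern finitely many terms each, and so are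
  preserved by products and pointwise limits.\<close>

definition hausdorff :: "(nat \<Rightarrow> real) \<Rightarrow> bool" where
  "hausdorff a \<longleftrightarrow> (\<forall>k n. 0 \<le> (decrement ^^ k) a n)"

lemma hausdorffD: "hausdorff a \<Longrightarrow> 0 \<le> (decrement ^^ k) a n"
  by (simp add: hausdorff_def)

lemma hausdorff_nonneg: "hausdorff a \<Longrightarrow> 0 \<le> a n"
  using hausdorffD[of a 0 n] by simp

lemma decrement_funpow_add:
  "(decrement ^^ k) (\<lambda>n. a n + b n) = (\<lambda>n. (decrement ^^ k) a n + (decrement ^^ k) b n)"
  by (induction k) (auto simp: decrement_def fun_eq_iff)

lemma decrement_funpow_cmult:
  "(decrement ^^ k) (\<lambda>n. c * a n) = (\<lambda>n. c * (decrement ^^ k) a n)"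
  by (induction k) (auto simp: decrement_def fun_eq_iff algebra_simps)

lemma decrement_funpow_shift:
  "(decrement ^^ k) (\<lambda>n. a (n + m)) = (\<lambda>n. (decrement ^^ k) a (n + m))"
  by (induction k) (auto simp: decrement_def fun_eq_iff)

lemma decrement_funpow_power:
  "(decrement ^^ k) (\<lambda>n. q ^ n) = (\<lambda>n. (1 - q) ^ k * q ^ n)"
  by (induction k) (auto simp: decrement_def fun_eq_iff algebra_simps)

lemma tendsto_decrement_funpow:
  assumes "\<And>n. (\<lambda>i. A i n) \<longlonglongrightarrow> a n"
  shows "(\<lambda>i. (decrement ^^ k) (A i) n) \<longlonglongrightarrow> (decrement ^^ k) a n"
proof (induction k arbitrary: n)
  case (Suc k)
  then show ?case by (auto simp: decrement_def[of "(decrement ^^ k) _"] intro!: tendsto_diff)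
qed (simp add: assms)

lemma hausdorff_decrement: "hausdorff a \<Longrightarrow> hausdorff (decrement a)"
  unfolding hausdorff_def by (metis funpow_Suc_right o_apply)

lemma hausdorff_shift: "hausdorff a \<Longrightarrow> hausdorff (\<lambda>n. a (n + m))"
  by (simp add: hausdorff_def decrement_funpow_shift)

lemma hausdorff_add: "hausdorff a \<Longrightarrow> hausdorff b \<Longrightarrow> hausdorff (\<lambda>n. a n + b n)"
  by (simp add: hausdorff_def decrement_funpow_add)

lemma hausdorff_cmult: "c \<ge> 0 \<Longrightarrow> hausdorff a \<Longrightarrow> hausdorff (\<lambda>n. c * a n)"
  by (simp add: hausdorff_def decrement_funpow_cmult)

lemma hausdorff_power: "0 \<le> q \<Longrightarrow> q \<le> 1 \<Longrightarrow> hausdorff (\<lambda>n. q ^ n)"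
  by (simp add: hausdorff_def decrement_funpow_power)

lemma hausdorff_limit:
  assumes "\<And>n. (\<lambda>i. A i n) \<longlonglongrightarrow> a n" and "\<And>i. hausdorff (A i)"
  shows "hausdorff a"
  unfolding hausdorff_def
proof (intro allI)
  fix k n
  show "0 \<le> (decrement ^^ k) a n"
    by (rule LIMSEQ_le_const[OF tendsto_decrement_funpow[of A, OF assms(1)]])
      (simp add: hausdorffD[OF assms(2)])
qed

lemma hausdorff_sum:
  assumes "finite I" and "\<And>i. i \<in> I \<Longrightarrow> hausdorff (A i)"
  shows "hausdorff (\<lambda>n. \<Sum>i\<in>I. A i n)"
  using assms
proof (induction I)
  case empty
  then show ?case using hausdorff_cmult[OF _ hausdorff_power[of 1], of 0] by simp
next
  case (insert i I)
  then show ?case using hausdorff_add[of "A i" "\<lambda>n. \<Sum>i\<in>I. A i n"] by simp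
qed

text \<open>By the Leibniz rule for \<open>decrement\<close>, the difference of a product is a sum of two products of Hausdorff sequences, to which the induction hypothesis applies again.\<close>

lemma hausdorff_mult:
  assumes "hausdorff a" and "hausdorff b"
  shows "hausdorff (\<lambda>n. a n * b n)"
proof -
  have "0 \<le> (decrement ^^ k) (\<lambda>n. a n * b n) n" if "hausdorff a" "hausdorff b" for k a b n
    using that
  proof (induction k arbitrary: a b n)
    case 0
    then show ?case by (simp add: hausdorff_nonneg)
  next
    case (Suc k)
    have "decrement (\<lambda>n. a n * b n) =
        (\<lambda>n. a n * decrement b n + decrement a n * b (n + 1))"
      by (auto simp: decrement_def fun_eq_iff algebra_simps)
    then show ?case
      unfolding funpow_Suc_right o_apply
      using Suc.IH[OF Suc.prems(1) hausdorff_decrement[OF Suc.prems(2)]]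
        Suc.IH[OF hausdorff_decrement[OF Suc.prems(1)] hausdorff_shift[OF Suc.prems(2), of 1]]
      by (simp add: decrement_funpow_add)
  qed
  then show ?thesis using assms by (simp add: hausdorff_def)
qed

lemma hausdorff_funpow_mult:
  assumes "hausdorff a"
  shows "hausdorff (\<lambda>n. a n ^ k)"
proof (induction k)
  case 0
  then show ?case using hausdorff_power[of 1] by simp
next
  case (Suc k)
  then show ?case using hausdorff_mult[OF assms Suc.IH] by simp
qed

lemma hausdorff_exp:
  assumes "hausdorff a"
  shows "hausdorff (\<lambda>n. exp (a n))"
proof (rule hausdorff_limit)
  show "(\<lambda>i. \<Sum>k<i. inverse (fact k) * a n ^ k) \<longlonglongrightarrow> exp (a n)" for n
    using exp_converges[of "a n"] by (simp add: sums_def)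
  show "hausdorff (\<lambda>n. \<Sum>k<i. inverse (fact k) * a n ^ k)" for i
    by (intro hausdorff_sum hausdorff_cmult hausdorff_funpow_mult assms) auto
qed

lemma hausdorff_le_0:
  assumes "hausdorff a"
  shows "a n \<le> a 0"
proof (induction n)
  case (Suc n)
  have "a (Suc n) \<le> a n" using hausdorffD[OF assms, of 1 n] by (simp add: decrement_def)
  with Suc show ?case by simp
qed simp

lemma hausdorff_entire:
  assumes "hausdorff a"
  shows "entire_seq a"
  unfolding entire_seq_def
proof
  fix x
  have "summable (\<lambda>n. a 0 * (inverse (fact n) * \<bar>x\<bar> ^ n))"
    using summable_exp[of "\<bar>x\<bar>"] by (intro summable_mult) simp
  moreover have "norm (a n / fact n * x ^ n) \<le> a 0 * (inverse (fact n) * \<bar>x\<bar> ^ n)" for n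
  proof -
    have "a n * (inverse (fact n) * \<bar>x\<bar> ^ n) \<le> a 0 * (inverse (fact n) * \<bar>x\<bar> ^ n)"
      by (intro mult_right_mono hausdorff_le_0[OF assms]) auto
    then show ?thesis
      using hausdorff_nonneg[OF assms, of n] by (simp add: abs_mult power_abs field_simps)
  qed
  ultimately show "summable (\<lambda>n. a n / fact n * x ^ n)"
    by (blast intro: summable_comparison_test')
qed

lemma decrement_funpow_eq_sum:
  "(decrement ^^ k) a n = (\<Sum>j\<le>k. (-1) ^ j * real (k choose j) * a (n + j))"
proof (induction k arbitrary: a n)
  case (Suc k)
  have "(decrement ^^ Suc k) a n =
      (\<Sum>j\<le>k. (-1) ^ j * real (k choose j) * a (n + j)) +
      (\<Sum>j\<le>k. (-1) ^ Suc j * real (k choose j) * a (n + Suc j))"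
    by (simp add: decrement_def Suc.IH sum_negf)
  also have "(\<Sum>j\<le>k. (-1) ^ j * real (k choose j) * a (n + j)) =
      (\<Sum>j\<le>Suc k. (-1) ^ j * real (k choose j) * a (n + j))"
    by simp
  also have "\<dots> = a n + (\<Sum>j\<le>k. (-1) ^ Suc j * real (k choose Suc j) * a (n + Suc j))"
    by (subst sum.atMost_Suc_shift) simp
  also have "\<dots> + (\<Sum>j\<le>k. (-1) ^ Suc j * real (k choose j) * a (n + Suc j)) =
      a n + (\<Sum>j\<le>k. (-1) ^ Suc j * real (Suc k choose Suc j) * a (n + Suc j))"
    by (simp add: algebra_simps flip: sum.distrib)
  also have "\<dots> = (\<Sum>j\<le>Suc k. (-1) ^ j * real (Suc k choose j) * a (n + j))"
    unfolding sum.atMost_Suc_shift[of _ k] by simp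
  finally show ?case .
qed simp

text \<open>Multiplication by \<open>exp x\<close> is the binomial transform: the coefficients of \<open>exp x * egf_neg a x\<close> are
  the iterated differences of \<open>a\<close> at \<open>0\<close>.\<close>

lemma hausdorff_egf_neg_nonneg:
  assumes "hausdorff a" and "x \<ge> 0"
  shows "egf_neg a x \<ge> 0"
proof -
  define u where "u n = x ^ n / fact n" for n :: nat
  define v where "v n = a n / fact n * (- x) ^ n" for n
  have "summable (\<lambda>n. norm (u n))"
    using summable_exp[of x] \<open>x \<ge> 0\<close> by (simp add: u_def field_simps)
  moreover have "summable (\<lambda>n. norm (v n))"
    using entire_seqD[OF hausdorff_entire[OF assms(1)], of x] assms hausdorff_nonneg[OF assms(1)]
    by (simp add: v_def abs_mult power_abs)
  ultimately have "(\<lambda>k. \<Sum>i\<le>k. v i * u (k - i)) sums ((\<Sum>k. v k) * (\<Sum>k. u k))"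
    by (rule Cauchy_product_sums[rotated])
  moreover have "(\<Sum>i\<le>k. v i * u (k - i)) = x ^ k / fact k * (decrement ^^ k) a 0" for k
    unfolding decrement_funpow_eq_sum sum_distrib_left u_def v_def
  proof (rule sum.cong, goal_cases)
    case (2 i)
    then have "x ^ k = x ^ i * x ^ (k - i)" by (simp flip: power_add)
    moreover have "(- x) ^ i = (- 1) ^ i * x ^ i" by (rule power_minus)
    ultimately show ?case using 2 by (simp add: binomial_fact field_simps)
  qed simp
  ultimately have "(\<lambda>k. x ^ k / fact k * (decrement ^^ k) a 0) sums ((\<Sum>k. v k) * (\<Sum>k. u k))"
    by simp
  moreover have "0 \<le> x ^ k / fact k * (decrement ^^ k) a 0" for k
    using hausdorffD[OF assms(1)] \<open>x \<ge> 0\<close> by simp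
  ultimately have "0 \<le> (\<Sum>k. v k) * (\<Sum>k. u k)"
    by (rule sums_le[OF _ sums_zero, rotated]) 
  moreover have "(\<Sum>k. u k) = exp x"
    by (simp add: u_def exp_def divide_inverse mult.commute)
  ultimately show ?thesis
    by (simp add: egf_neg_def v_def zero_le_mult_iff)
qed

text \<open>Taylor truncations of \<open>exp (-x u)\<close>, \<open>u \<ge> 0\<close>, are alternately too large and too small, and
  this persists for mixtures over \<open>u \<in> [0, 1]\<close>. The induction works because the derivative of
  the error is, up to sign, the error of one order less for the shifted sequence.\<close>

lemma hausdorff_truncation_sign:
  assumes "hausdorff a" and "x \<ge> 0"
  shows "0 \<le> (-1) ^ p * (egf_neg a x - (\<Sum>n<p. a n / fact n * (- x) ^ n))"
  using assms
proof (induction p arbitrary: a x)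
  case 0
  then show ?case by (simp add: hausdorff_egf_neg_nonneg)
next
  case (Suc p)
  define d where "d y = (-1) ^ Suc p * (egf_neg a y - (\<Sum>n<Suc p. a n / fact n * (- y) ^ n))" for y
  define d' where "d' y = (-1) ^ p *
      (egf_neg (\<lambda>n. a (n + 1)) y - (\<Sum>n<p. a (n + 1) / fact n * (- y) ^ n))" for y
  have "d 0 \<le> d x"
  proof (rule DERIV_nonneg_imp_nondecreasing[OF Suc.prems(2)])
    fix y :: real assume "0 \<le> y"
    have "((\<lambda>y. \<Sum>n<Suc p. a n / fact n * (- y) ^ n) has_real_derivative
        (\<Sum>n<Suc p. a n / fact n * (real n * (- y) ^ (n - 1) * (- 1)))) (at y)"
      by (auto intro!: derivative_eq_intros sum.cong simp: mult_ac)
    also have "(\<Sum>n<Suc p. a n / fact n * (real n * (- y) ^ (n - 1) * (- 1))) =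
        - (\<Sum>n<p. a (n + 1) / fact n * (- y) ^ n)"
      unfolding sum.lessThan_Suc_shift by (simp flip: sum_negf add: divide_simps)
    finally have "((\<lambda>y. \<Sum>n<Suc p. a n / fact n * (- y) ^ n) has_real_derivative
        - (\<Sum>n<p. a (n + 1) / fact n * (- y) ^ n)) (at y)" .
    from DERIV_cmult[OF DERIV_diff[OF DERIV_egf_neg[OF hausdorff_entire[OF Suc.prems(1)]] this],
        of "(-1) ^ Suc p"]
    have "(d has_real_derivative d' y) (at y)"
      by (simp only: d_def[abs_def] d'_def power_Suc) (simp add: algebra_simps)
    moreover have "d' y \<ge> 0"
      unfolding d'_def by (intro Suc.IH hausdorff_shift Suc.prems \<open>0 \<le> y\<close>)
    ultimately show "\<exists>D. (d has_real_derivative D) (at y) \<and> 0 \<le> D" by blast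
  qed
  moreover have "d 0 = 0"
    unfolding d_def by (subst sum.lessThan_Suc_shift) simp
  ultimately show ?case by (simp add: d_def)
qed

text \<open>Truncations of odd length are finite sums, so that their nonnegativity survives pointwise
  limits of the coefficients; the length is sent to infinity only afterwards. The factors \<open>r i ^ n\<close> allow measures on \<open>[0, 1 / r i]\<close>, whose supports may grow with \<open>i\<close>.\<close>

lemma egf_neg_nonneg_limit:
  assumes conv: "\<And>n. (\<lambda>i. A i n) \<longlonglongrightarrow> a n"
    and r: "\<And>i. r i > 0" and hd: "\<And>i. hausdorff (\<lambda>n. r i ^ n * A i n)"
    and a: "entire_seq a" and x: "x \<ge> 0"
  shows "egf_neg a x \<ge> 0"
proof -
  have pos: "0 \<le> (\<Sum>n<2*m+1. A i n / fact n * (- x) ^ n)" for i m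
  proof -
    have "0 \<le> x / r i" using r[of i] x by simp
    from hausdorff_truncation_sign[OF hd[of i] this, of "2*m+1"]
      hausdorff_egf_neg_nonneg[OF hd[of i] this]
    have "0 \<le> (\<Sum>n<2*m+1. r i ^ n * A i n / fact n * (- (x / r i)) ^ n)" by simp
    also have "\<dots> = (\<Sum>n<2*m+1. A i n / fact n * (- x) ^ n)"
    proof (rule sum.cong, goal_cases)
      case (2 n)
      have "r i ^ n * (- (x / r i)) ^ n = (- x) ^ n"
        using r[of i] by (simp flip: power_mult_distrib)
      then show ?case by (simp add: field_simps)
    qed simp
    finally show ?thesis .
  qed
  have "0 \<le> (\<Sum>n<2*m+1. a n / fact n * (- x) ^ n)" for m
    by (rule LIMSEQ_le_const[of "\<lambda>i. \<Sum>n<2*m+1. A i n / fact n * (- x) ^ n"])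
      (use pos in \<open>auto intro!: tendsto_intros conv\<close>)
  moreover have "(\<lambda>m. \<Sum>n<2*m+1. a n / fact n * (- x) ^ n) \<longlonglongrightarrow> egf_neg a x"
    using LIMSEQ_subseq_LIMSEQ[OF summable_LIMSEQ[OF entire_seqD[OF a, of "- x"]],
        of "\<lambda>m. 2*m+1"]
    by (auto simp: strict_mono_def o_def egf_neg_def)
  ultimately show ?thesis by (auto intro: LIMSEQ_le_const)
qed

lemma completely_monotone_limit:
  assumes conv: "\<And>n. (\<lambda>i. A i n) \<longlonglongrightarrow> a n"
    and r: "\<And>i. r i > 0" and hd: "\<And>i. hausdorff (\<lambda>n. r i ^ n * A i n)"
    and a: "entire_seq a"
  shows "completely_monotone (egf_neg a)"
  unfolding completely_monotone_egf_neg_iff[OF a]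
proof (intro allI impI)
  fix k and x :: real assume "x > 0"
  show "0 \<le> egf_neg (\<lambda>n. a (n + k)) x"
  proof (rule egf_neg_nonneg_limit[where A = "\<lambda>i n. A i (n + k)" and r = r])
    show "hausdorff (\<lambda>n. r i ^ n * A i (n + k))" for i
    proof -
      have "hausdorff (\<lambda>n. (1 / r i ^ k) * (r i ^ (n + k) * A i (n + k)))"
        by (intro hausdorff_cmult hausdorff_shift[OF hd]) (use r[of i] in simp)
      then show ?thesis using r[of i] by (simp add: power_add)
    qed
  qed (use conv r entire_seq_shift[OF a] \<open>x > 0\<close> in simp_all)
qed

section \<open>Ratios of shifted products as Hausdorff sequences\<close>

text \<open>A discrete form of Frullani's integral for the logarithm: replacing each factor \<open>z\<close> by
  \<open>1 - exp (-h z)\<close>, the expansion \<open>-ln (1 - exp (-h z)) = \<Sum>m. exp (-h m z) / m\<close> turns the logarithm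
  of the quotient into a combination of the geometric sequences \<open>exp (-h m) ^ n\<close>, whose coefficients
  are nonnegative exactly by the hypothesis at \<open>t = h m\<close>. Exponentiating, and letting \<open>h\<close> tend to
  \<open>0\<close> after dividing each factor by \<open>h\<close>, gives the claim.\<close>

lemma hausdorff_prod_ratio:
  fixes u :: "'i \<Rightarrow> real" and v :: "'j \<Rightarrow> real" and \<gamma> :: real
  assumes "finite I" and "finite J"
    and u: "\<And>i. i \<in> I \<Longrightarrow> u i > 0" and v: "\<And>j. j \<in> J \<Longrightarrow> v j > 0"
    and dom: "\<And>t. t > 0 \<Longrightarrow> \<gamma> * (\<Sum>j\<in>J. exp (- t * v j)) \<le> (\<Sum>i\<in>I. exp (- t * u i))"
  shows "hausdorff (\<lambda>n. (\<Prod>j\<in>J. (v j + real n) powr \<gamma>) / (\<Prod>i\<in>I. u i + real n))"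
proof -
  define w where "w h z = 1 - exp (- h * z)" for h z :: real
  have w_pos: "w h z > 0" if "h > 0" "z > 0" for h z
    using that by (simp add: w_def)
  define L where "L h n = \<gamma> * (\<Sum>j\<in>J. ln (w h (v j + real n))) - (\<Sum>i\<in>I. ln (w h (u i + real n)))"
    for h n
  have L: "hausdorff (L h)" if h: "h > 0" for h
  proof (rule hausdorff_limit)
    \<comment> \<open>The index \<open>m = 0\<close> contributes \<open>0\<close> because of division by zero.\<close>
    define c where "c m = ((\<Sum>i\<in>I. exp (- (h * real m) * u i)) -
        \<gamma> * (\<Sum>j\<in>J. exp (- (h * real m) * v j))) / real m" for m
    have c: "c m \<ge> 0" for m
      using dom[of "h * real m"] h by (cases "m = 0") (simp_all add: c_def)
    show "hausdorff (\<lambda>n. \<Sum>m<k. c m * exp (- h * real m) ^ n)" for k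
      by (intro hausdorff_sum hausdorff_cmult hausdorff_power c) (use h in auto)
    have ser: "(\<lambda>m. exp (- (h * real m) * z) * exp (- h * real m) ^ n / real m)
        sums (- ln (w h (z + real n)))" if "z > 0" for z n
    proof -
      have "(\<lambda>m. - (- (exp (- h * (z + real n)) ^ m / real m))) sums (- ln (w h (z + real n)))"
        using ln_series'[of "- exp (- h * (z + real n))"] h that
        by (intro sums_minus) (simp add: w_def)
      then show ?thesis
        by (simp flip: exp_of_nat_mult exp_add add: algebra_simps)
    qed
    have "(\<lambda>m. (\<Sum>i\<in>I. exp (- (h * real m) * u i) * exp (- h * real m) ^ n / real m) -
           \<gamma> * (\<Sum>j\<in>J. exp (- (h * real m) * v j) * exp (- h * real m) ^ n / real m))
        sums ((\<Sum>i\<in>I. - ln (w h (u i + real n))) - \<gamma> * (\<Sum>j\<in>J. - ln (w h (v j + real n))))" for n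
      by (intro sums_diff sums_mult sums_sum ser u v)
    moreover have "(\<Sum>i\<in>I. exp (- (h * real m) * u i) * e / real m) -
        \<gamma> * (\<Sum>j\<in>J. exp (- (h * real m) * v j) * e / real m) = c m * e" for m e
      by (simp only: c_def flip: sum_divide_distrib sum_distrib_right)
        (simp add: diff_divide_distrib left_diff_distrib)
    ultimately have "(\<lambda>m. c m * exp (- h * real m) ^ n) sums L h n" for n
      by (simp add: L_def sum_negf)
    then show "(\<lambda>k. \<Sum>m<k. c m * exp (- h * real m) ^ n) \<longlonglongrightarrow> L h n" for n
      by (simp add: sums_def)
  qed
  define h where "h k = 1 / real (Suc k)" for k
  have h: "h k > 0" for k by (simp add: h_def)
  have exp_L: "exp (L h n) = (\<Prod>j\<in>J. w h (v j + real n) powr \<gamma>) / (\<Prod>i\<in>I. w h (u i + real n))"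
    if "h > 0" for h n
  proof -
    have "exp (L h n) = (\<Prod>j\<in>J. exp (\<gamma> * ln (w h (v j + real n)))) /
        (\<Prod>i\<in>I. exp (ln (w h (u i + real n))))"
      using assms(1,2) by (simp add: L_def exp_diff exp_sum sum_distrib_left)
    also have "(\<Prod>j\<in>J. exp (\<gamma> * ln (w h (v j + real n)))) = (\<Prod>j\<in>J. w h (v j + real n) powr \<gamma>)"
      using w_pos[OF that] v by (intro prod.cong) (auto simp: powr_def add_pos_nonneg less_imp_neq[THEN not_sym])
    also have "(\<Prod>i\<in>I. exp (ln (w h (u i + real n)))) = (\<Prod>i\<in>I. w h (u i + real n))"
      using w_pos[OF that] u by (intro prod.cong) (auto simp: add_pos_nonneg)
    finally show ?thesis .
  qed
  have w_lim: "(\<lambda>k. w (h k) z / h k) \<longlonglongrightarrow> z" for z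
    unfolding w_def h_def by real_asymp
  show ?thesis
  proof (rule hausdorff_limit)
    show "hausdorff (\<lambda>n. (h k ^ card I / (h k powr \<gamma>) ^ card J) * exp (L (h k) n))" for k
      by (intro hausdorff_cmult hausdorff_exp L h) (use h[of k] in auto)
    show "(\<lambda>k. (h k ^ card I / (h k powr \<gamma>) ^ card J) * exp (L (h k) n)) \<longlonglongrightarrow>
        (\<Prod>j\<in>J. (v j + real n) powr \<gamma>) / (\<Prod>i\<in>I. u i + real n)" for n
    proof -
      have "(h k ^ card I / (h k powr \<gamma>) ^ card J) * exp (L (h k) n) =
          (\<Prod>j\<in>J. (w (h k) (v j + real n) / h k) powr \<gamma>) / (\<Prod>i\<in>I. w (h k) (u i + real n) / h k)" for k
        using h[of k] w_pos[OF h] v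
        by (simp add: exp_L[OF h] prod_dividef powr_divide less_imp_le)
      moreover have "(\<lambda>k. (\<Prod>j\<in>J. (w (h k) (v j + real n) / h k) powr \<gamma>) /
            (\<Prod>i\<in>I. w (h k) (u i + real n) / h k)) \<longlonglongrightarrow>
          (\<Prod>j\<in>J. (v j + real n) powr \<gamma>) / (\<Prod>i\<in>I. u i + real n)"
        using u v assms(1)
        by (intro tendsto_divide tendsto_prod tendsto_powr w_lim tendsto_const)
          (force simp: add_pos_nonneg prod_zero_iff)+
      ultimately show ?thesis by simp
    qed
  qed
qed

section \<open>Comparison of the exponential sums\<close>

lemma mult_sinh_le: 
  fixes c s :: real
  assumes "c \<ge> 1" and "s \<ge> 0"
  shows "c * sinh s \<le> sinh (c * s)"
proof -
  have "sinh (c * 0) - c * sinh 0 \<le> sinh (c * s) - c * sinh s"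
  proof (rule DERIV_nonneg_imp_nondecreasing[OF assms(2)])
    fix x :: real assume "0 \<le> x"
    have "((\<lambda>s. sinh (c * s) - c * sinh s) has_real_derivative c * (cosh (c * x) - cosh x)) (at x)"
      by (auto intro!: derivative_eq_intros simp: algebra_simps)
    moreover have "x \<le> c * x" using assms \<open>0 \<le> x\<close> by (simp add: mult_le_cancel_right1)
    then have "cosh x \<le> cosh (c * x)"
      using assms \<open>0 \<le> x\<close> by (subst cosh_real_nonneg_le_iff) auto
    ultimately show "\<exists>y. ((\<lambda>s. sinh (c * s) - c * sinh s) has_real_derivative y) (at x) \<and> 0 \<le> y"
      using assms by (intro exI[of _ "c * (cosh (c * x) - cosh x)"]) auto
  qed
  then show ?thesis by simp
qed

lemma mult_one_minus_exp_le:
  fixes \<gamma> t :: real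
  assumes "0 < \<gamma>" and "\<gamma> \<le> 1"
  shows "\<gamma> * (1 - exp (- t)) \<le> 1 - exp (- (\<gamma> * t))"
  using convex_onD[OF exp_convex, of \<gamma> 0 "- t"] assms by (simp add: algebra_simps)

text \<open>Both cases rest on \<open>1 - exp (-t/\<alpha>) \<ge> 1 - exp (-\<gamma> t)\<close>, that is \<open>\<alpha> \<gamma> \<le> 1\<close>. For \<open>\<gamma> > 1\<close> the value
  \<open>\<beta> / \<alpha> = (1 + \<gamma>) / 2\<close> is the one that symmetrises the remaining inequality into
  \<open>\<gamma> sinh (t/2) \<le> sinh (\<gamma> t/2)\<close>.\<close>

lemma density_comparison:
  fixes \<alpha> \<beta> \<gamma> t :: real
  assumes "\<alpha> > 0" "\<gamma> > 0" "t > 0" "\<alpha> * \<gamma> \<le> 1"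
    and \<beta>: "\<beta> \<ge> (if \<gamma> \<le> 1 then \<alpha> else \<alpha> * (1 + \<gamma>) / 2)"
  shows "\<gamma> * exp (- t * (\<beta> / \<alpha>)) * (1 - exp (- t)) \<le> exp (- t) * (1 - exp (- t / \<alpha>))"
proof -
  have "\<gamma> \<le> 1 / \<alpha>" using assms by (simp add: field_simps)
  then have "\<gamma> * t \<le> t / \<alpha>"
    using mult_right_mono[of \<gamma> "1 / \<alpha>" t] \<open>t > 0\<close> by simp
  then have g: "1 - exp (- (\<gamma> * t)) \<le> 1 - exp (- t / \<alpha>)" by simp
  show ?thesis
  proof (cases "\<gamma> \<le> 1")
    case True
    have "1 \<le> \<beta> / \<alpha>" using True \<beta> assms by simp
    then have "exp (- t * (\<beta> / \<alpha>)) \<le> exp (- t)"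
      using mult_left_mono[of 1 "\<beta> / \<alpha>" t] \<open>t > 0\<close> by simp
    moreover have "\<gamma> * (1 - exp (- t)) \<le> 1 - exp (- t / \<alpha>)"
      using mult_one_minus_exp_le[of \<gamma> t] True assms g by linarith
    ultimately have "exp (- t * (\<beta> / \<alpha>)) * (\<gamma> * (1 - exp (- t))) \<le> exp (- t) * (1 - exp (- t / \<alpha>))"
      by (rule mult_mono) (use assms in auto)
    then show ?thesis by (simp add: mult_ac)
  next
    case False
    have "(1 + \<gamma>) / 2 \<le> \<beta> / \<alpha>" using False \<beta> assms by (simp add: field_simps)
    then have "exp (- t * (\<beta> / \<alpha>)) \<le> exp (- t * ((1 + \<gamma>) / 2))"
      using mult_left_mono[of "(1 + \<gamma>) / 2" "\<beta> / \<alpha>" t] \<open>t > 0\<close> by simp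
    then have "exp (- t * (\<beta> / \<alpha>)) * (\<gamma> * (1 - exp (- t))) \<le>
        exp (- t * ((1 + \<gamma>) / 2)) * (\<gamma> * (1 - exp (- t)))"
      by (rule mult_right_mono) (use assms in auto)
    also have "\<dots> = exp (- t) * exp (- (\<gamma> * t / 2)) * (2 * (\<gamma> * sinh (t / 2)))"
    proof -
      have e: "exp (- t * ((1 + \<gamma>) / 2)) = exp (- t) * exp (- (\<gamma> * t / 2)) * exp (t / 2)"
        by (simp flip: exp_add add: field_simps)
      moreover have "exp (t / 2) * (1 - exp (- t)) = 2 * sinh (t / 2)"
        by (simp add: sinh_def algebra_simps flip: exp_add)
      moreover have "exp (- t * ((1 + \<gamma>) / 2)) * (\<gamma> * (1 - exp (- t))) =
          exp (- t) * exp (- (\<gamma> * t / 2)) * (\<gamma> * (exp (t / 2) * (1 - exp (- t))))"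
        unfolding e by (simp only: mult_ac)
      ultimately show ?thesis by (simp only: mult_ac)
    qed
    also have "\<dots> \<le> exp (- t) * exp (- (\<gamma> * t / 2)) * (2 * sinh (\<gamma> * (t / 2)))"
      using mult_sinh_le[of \<gamma> "t / 2"] False \<open>t > 0\<close> by (intro mult_left_mono) auto
    also have "\<dots> = exp (- t) * (1 - exp (- (\<gamma> * t)))"
      by (simp add: sinh_def algebra_simps flip: exp_add)
    also have "\<dots> \<le> exp (- t) * (1 - exp (- t / \<alpha>))"
      using g by simp
    finally show ?thesis by (simp add: mult_ac)
  qed
qed

lemma sum_exp_geometric:
  fixes t c d :: real
  assumes "t > 0" "d > 0"
  shows "(\<Sum>j<m. exp (- t * (c + real j * d))) =
    exp (- t * c) * (1 - exp (- t * (real m * d))) / (1 - exp (- t * d))"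
proof -
  have "(\<Sum>j<m. exp (- t * (c + real j * d))) = exp (- t * c) * (\<Sum>j<m. exp (- t * d) ^ j)"
    by (simp add: sum_distrib_left flip: exp_of_nat_mult exp_add) (simp add: algebra_simps)
  also have "(\<Sum>j<m. exp (- t * d) ^ j) = (1 - exp (- t * d) ^ m) / (1 - exp (- t * d))"
    using assms by (subst sum_gp_strict) auto
  also have "exp (- t * d) ^ m = exp (- t * (real m * d))"
    by (simp add: algebra_simps flip: exp_of_nat_mult)
  finally show ?thesis by simp
qed

text \<open>The relation between \<open>M\<close> and \<open>N\<close> keeps the finite sums comparable as well as the infinite
  ones: the missing tail on the right is relatively smaller than the one on the left.\<close>

lemma exp_sums_comparison:
  fixes \<alpha> \<beta> \<gamma> t :: real
  assumes "\<alpha> > 0" "\<gamma> > 0" "t > 0" "\<alpha> * \<gamma> \<le> 1"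
    and "\<beta> \<ge> (if \<gamma> \<le> 1 then \<alpha> else \<alpha> * (1 + \<gamma>) / 2)"
    and M: "real M / \<alpha> \<le> real N"
  shows "\<gamma> * (\<Sum>j<M. exp (- t * (\<beta> / \<alpha> + real j * (1 / \<alpha>)))) \<le> (\<Sum>i<N. exp (- t * (1 + real i * 1)))"
proof -
  have pos: "1 - exp (- t * (1 / \<alpha>)) > 0" "1 - exp (- t * 1) > 0" using assms by simp_all
  have "\<gamma> * exp (- t * (\<beta> / \<alpha>)) / (1 - exp (- t * (1 / \<alpha>))) \<le> exp (- t * 1) / (1 - exp (- t * 1))"
    using density_comparison[OF assms(1-5)] pos \<open>\<alpha> > 0\<close> by (simp add: divide_simps)
  moreover have "1 - exp (- t * (real M * (1 / \<alpha>))) \<le> 1 - exp (- t * (real N * 1))"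
    using mult_left_mono[OF M, of t] \<open>t > 0\<close> by simp
  ultimately have "\<gamma> * exp (- t * (\<beta> / \<alpha>)) / (1 - exp (- t * (1 / \<alpha>))) *
        (1 - exp (- t * (real M * (1 / \<alpha>)))) \<le>
      exp (- t * 1) / (1 - exp (- t * 1)) * (1 - exp (- t * (real N * 1)))"
    by (rule mult_mono) (use assms in auto)
  moreover have "1 / \<alpha> > 0" using \<open>\<alpha> > 0\<close> by simp
  ultimately show ?thesis
    unfolding sum_exp_geometric[OF \<open>t > 0\<close> zero_less_one]
      sum_exp_geometric[OF \<open>t > 0\<close> \<open>1 / \<alpha> > 0\<close>] by (simp add: mult_ac)
qed

section \<open>Growth of the Gamma function\<close>

lemma Gamma_plus1_pos: "x > 0 \<Longrightarrow> Gamma (x + 1) = x * Gamma x" for x :: real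
  by (intro Gamma_plus1) (use nonpos_Ints_nonpos[of x] in linarith)

lemma ln_Gamma_plus1_pos: "x > 0 \<Longrightarrow> ln (Gamma (x + 1)) = ln (Gamma x) + ln x" for x :: real
  using less_imp_neq[OF Gamma_real_pos, of x] by (simp add: Gamma_plus1_pos ln_mult)

text \<open>The slope of the convex function \<open>ln \<Gamma>\<close> between \<open>z\<close> and \<open>z + \<alpha>\<close> lies between its slopes
  over the unit intervals to the left and to the right, which the functional equation evaluates.\<close>

lemma Gamma_add_bounds:
  fixes z \<alpha> :: real
  assumes "z > 1" and "\<alpha> > 0"
  shows "(z - 1) powr \<alpha> * Gamma z \<le> Gamma (z + \<alpha>)"
    and "Gamma (z + \<alpha>) \<le> (z + \<alpha>) powr \<alpha> * Gamma z"
proof -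
  define f where "f = (ln \<circ> Gamma :: real \<Rightarrow> real)"
  have f: "Gamma x = exp (f x)" if "x > 0" for x
    using that by (simp add: f_def)
  have step: "f (x + 1) = f x + ln x" if "x > 0" for x
    using ln_Gamma_plus1_pos[OF that] by (simp add: f_def)
  have conv: "convex_on {0<..} f" unfolding f_def by (rule log_convex_Gamma_real)
  have "(f (z - 1) - f z) / ((z - 1) - z) \<le> (f (z - 1) - f (z + \<alpha>)) / ((z - 1) - (z + \<alpha>))"
    "(f (z - 1) - f (z + \<alpha>)) / ((z - 1) - (z + \<alpha>)) \<le> (f z - f (z + \<alpha>)) / (z - (z + \<alpha>))"
    using convex_on_slope_le[OF conv, of "z - 1" "z + \<alpha>" z] assms by auto
  moreover have "(f (z - 1) - f z) / ((z - 1) - z) = ln (z - 1)"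
    using step[of "z - 1"] assms by simp
  moreover have "(f z - f (z + \<alpha>)) / (z - (z + \<alpha>)) = (f (z + \<alpha>) - f z) / \<alpha>"
    using assms by (simp add: divide_simps)
  ultimately have "ln (z - 1) \<le> (f (z + \<alpha>) - f z) / \<alpha>"
    by linarith
  then have "\<alpha> * ln (z - 1) + f z \<le> f (z + \<alpha>)"
    using assms by (simp add: field_simps)
  then have "exp (\<alpha> * ln (z - 1) + f z) \<le> exp (f (z + \<alpha>))" by simp
  then show "(z - 1) powr \<alpha> * Gamma z \<le> Gamma (z + \<alpha>)"
    using assms by (simp add: f exp_add powr_def)
  have "(f z - f (z + \<alpha>)) / (z - (z + \<alpha>)) \<le> (f z - f (z + \<alpha> + 1)) / (z - (z + \<alpha> + 1))"
    "(f z - f (z + \<alpha> + 1)) / (z - (z + \<alpha> + 1)) \<le> (f (z + \<alpha>) - f (z + \<alpha> + 1)) / ((z + \<alpha>) - (z + \<alpha> + 1))"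
    using convex_on_slope_le[OF conv, of z "z + \<alpha> + 1" "z + \<alpha>"] assms by auto
  moreover have "(f z - f (z + \<alpha>)) / (z - (z + \<alpha>)) = (f (z + \<alpha>) - f z) / \<alpha>"
    using assms by (simp add: divide_simps)
  moreover have "(f (z + \<alpha>) - f (z + \<alpha> + 1)) / ((z + \<alpha>) - (z + \<alpha> + 1)) = ln (z + \<alpha>)"
    using step[of "z + \<alpha>"] assms by simp
  ultimately have "(f (z + \<alpha>) - f z) / \<alpha> \<le> ln (z + \<alpha>)"
    by linarith
  then have "f (z + \<alpha>) \<le> \<alpha> * ln (z + \<alpha>) + f z"
    using assms by (simp add: field_simps)
  then have "exp (f (z + \<alpha>)) \<le> exp (\<alpha> * ln (z + \<alpha>) + f z)" by simp
  then show "Gamma (z + \<alpha>) \<le> (z + \<alpha>) powr \<alpha> * Gamma z"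
    using assms by (simp add: f exp_add powr_def)
qed

section \<open>Sufficiency\<close>

text \<open>Normalised such that the terms of the series are \<open>a n x ^ n / n!\<close>: these are the moments of the
  measure of which \<open>F(-x)\<close> is the Laplace transform, if it is completely monotone.\<close>

definition le_roy_moment :: "real \<Rightarrow> real \<Rightarrow> real \<Rightarrow> nat \<Rightarrow> real" where
  "le_roy_moment \<alpha> \<beta> \<gamma> n = fact n / Gamma (\<beta> + \<alpha> * real n) powr \<gamma>"

context
  fixes \<alpha> \<beta> \<gamma> :: real
  assumes pos: "\<alpha> > 0" "\<beta> > 0" "\<gamma> > 0"
begin

lemma Gamma_arg_pos: "Gamma (\<beta> + \<alpha> * real n) > 0"
  using pos by (intro Gamma_real_pos add_pos_nonneg) auto

lemma le_roy_moment_pos: "le_roy_moment \<alpha> \<beta> \<gamma> n > 0"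
  using Gamma_arg_pos[of n] by (simp add: le_roy_moment_def)

lemma le_roy_moment_entire: "entire_seq (le_roy_moment \<alpha> \<beta> \<gamma>)"
  unfolding entire_seq_def
proof
  fix x :: real
  define b where "b n = le_roy_moment \<alpha> \<beta> \<gamma> n / fact n * x ^ n" for n
  define \<rho> where "\<rho> n = \<bar>x\<bar> / (\<beta> + \<alpha> * real n - 1) powr (\<alpha> * \<gamma>)" for n
  have "\<rho> \<longlonglongrightarrow> 0"
    unfolding \<rho>_def using pos by real_asymp
  moreover have "eventually (\<lambda>n. \<beta> + \<alpha> * real n > 1) sequentially"
    using pos by real_asymp
  ultimately have "eventually (\<lambda>n. \<rho> n < 1 / 2 \<and> \<beta> + \<alpha> * real n > 1) sequentially"
    using order_tendstoD(2)[of \<rho> 0 sequentially "1 / 2"] eventually_conj by auto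
  then obtain N where N: "\<And>n. n \<ge> N \<Longrightarrow> \<rho> n < 1 / 2 \<and> \<beta> + \<alpha> * real n > 1"
    by (auto simp: eventually_sequentially)
  show "summable b"
  proof (rule summable_ratio_test[of "1/2" N])
    fix n assume "n \<ge> N"
    define z where "z = \<beta> + \<alpha> * real n"
    have z: "z > 1" "\<rho> n < 1 / 2" using N[OF \<open>n \<ge> N\<close>] by (auto simp: z_def)
    have G: "Gamma z > 0" "Gamma (z + \<alpha>) > 0" using z pos by (auto intro!: Gamma_real_pos)
    have z': "\<beta> + \<alpha> * real (Suc n) = z + \<alpha>" by (simp add: z_def algebra_simps)
    have "((z - 1) powr \<alpha> * Gamma z) powr \<gamma> \<le> Gamma (z + \<alpha>) powr \<gamma>"
      using Gamma_add_bounds(1)[OF z(1) pos(1)] G pos by (intro powr_mono2) auto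
    then have le: "(z - 1) powr (\<alpha> * \<gamma>) * Gamma z powr \<gamma> \<le> Gamma (z + \<alpha>) powr \<gamma>"
      using G by (simp add: powr_mult powr_powr)
    have "norm (b (Suc n)) = \<bar>x\<bar> * \<bar>x\<bar> ^ n / Gamma (z + \<alpha>) powr \<gamma>"
      unfolding b_def le_roy_moment_def z' by (simp add: abs_mult power_abs)
    also have "\<dots> \<le> \<bar>x\<bar> * \<bar>x\<bar> ^ n / ((z - 1) powr (\<alpha> * \<gamma>) * Gamma z powr \<gamma>)"
      using z G by (intro divide_left_mono[OF le]) (auto intro!: mult_pos_pos simp: less_imp_neq[THEN not_sym])
    also have "\<dots> = \<rho> n * norm (b n)"
      unfolding b_def le_roy_moment_def \<rho>_def by (simp add: z_def abs_mult power_abs)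
    also have "\<dots> \<le> 1 / 2 * norm (b n)"
      using z by (intro mult_right_mono) auto
    finally show "norm (b (Suc n)) \<le> 1 / 2 * norm (b n)" .
  qed simp
qed

lemma le_roy_neg_eq_egf_neg: "le_roy_neg \<alpha> \<beta> \<gamma> = egf_neg (le_roy_moment \<alpha> \<beta> \<gamma>)"
proof
  fix x
  have "(\<lambda>n. complex_of_real (le_roy_moment \<alpha> \<beta> \<gamma> n / fact n * (- x) ^ n)) sums
      complex_of_real (egf_neg (le_roy_moment \<alpha> \<beta> \<gamma>) x)"
    unfolding sums_of_real_iff egf_neg_def
    using entire_seqD[OF le_roy_moment_entire] by (rule summable_sums)
  also have "(\<lambda>n. complex_of_real (le_roy_moment \<alpha> \<beta> \<gamma> n / fact n * (- x) ^ n)) =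
      (\<lambda>n. complex_of_real (- x) ^ n / complex_of_real (Gamma (\<beta> + \<alpha> * real n) powr \<gamma>))"
    by (simp add: le_roy_moment_def)
  finally show "le_roy_neg \<alpha> \<beta> \<gamma> x = egf_neg (le_roy_moment \<alpha> \<beta> \<gamma>) x"
    by (simp add: le_roy_neg_def le_roy_def sums_iff)
qed

lemma completely_monotone_le_roy:
  assumes "\<alpha> * \<gamma> \<le> 1" and "\<beta> \<ge> (if \<gamma> \<le> 1 then \<alpha> else \<alpha> * (1 + \<gamma>) / 2)"
  shows "completely_monotone (le_roy_neg \<alpha> \<beta> \<gamma>)"
  unfolding le_roy_neg_eq_egf_neg
proof (rule completely_monotone_limit)
  \<comment> \<open>The number of linear factors in the two Gauss products has to be coordinated so that
    \<open>exp_sums_comparison\<close> applies.\<close>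
  define K where "K M = nat \<lceil>real (Suc M) / \<alpha>\<rceil>" for M
  define A where "A M n = Gamma_series (1 + real n) (K M) / Gamma_series (\<beta> + \<alpha> * real n) M powr \<gamma>" for M n
  \<comment> \<open>\<open>1 / r M\<close> is the base of the geometric factor that the two Gauss products leave over.\<close>
  define r where "r M = exp (\<alpha> * \<gamma> * ln (real M) - ln (real (K M)))" for M
  show "entire_seq (le_roy_moment \<alpha> \<beta> \<gamma>)" by (rule le_roy_moment_entire)
  show "r M > 0" for M by (simp add: r_def)
  show "(\<lambda>M. A M n) \<longlonglongrightarrow> le_roy_moment \<alpha> \<beta> \<gamma> n" for n
  proof -
    have "filterlim K at_top sequentially"
      unfolding K_def using pos by real_asymp
    then have "(\<lambda>M. Gamma_series (1 + real n) (K M)) \<longlonglongrightarrow> Gamma (1 + real n)"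
      using filterlim_compose[OF Gamma_series_LIMSEQ] by blast
    moreover have "Gamma (1 + real n) = fact n"
      using Gamma_fact[of n, where 'a = real] by simp
    ultimately show ?thesis
      unfolding A_def le_roy_moment_def using Gamma_arg_pos[of n]
      by (auto intro!: tendsto_divide tendsto_powr Gamma_series_LIMSEQ)
  qed
  show "hausdorff (\<lambda>n. r M ^ n * A M n)" for M
  proof -
    define k where "k = K M"
    define C where "C = fact k * exp (ln (real k)) /
        ((fact M * exp (\<beta> * ln (real M)) / \<alpha> ^ Suc M) powr \<gamma>)"
    have "C > 0" unfolding C_def using pos by simp
    have "real (Suc M) / \<alpha> \<le> real (Suc k)" unfolding k_def K_def by linarith
    note dom = exp_sums_comparison[OF pos(1,3) _ assms this]
    have hd: "hausdorff (\<lambda>n. (\<Prod>j<Suc M. (\<beta> / \<alpha> + real j * (1 / \<alpha>) + real n) powr \<gamma>) /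
        (\<Prod>i<Suc k. 1 + real i * 1 + real n))"
      using pos by (intro hausdorff_prod_ratio dom) (auto intro!: add_pos_nonneg)
    have "r M ^ n * A M n = C * ((\<Prod>j<Suc M. (\<beta> / \<alpha> + real j * (1 / \<alpha>) + real n) powr \<gamma>) /
        (\<Prod>i<Suc k. 1 + real i * 1 + real n))" for n
    proof -
      have "pochhammer (\<beta> + \<alpha> * real n) (Suc M) = \<alpha> ^ Suc M * (\<Prod>j<Suc M. \<beta> / \<alpha> + real j * (1 / \<alpha>) + real n)"
      proof -
        have "pochhammer (\<beta> + \<alpha> * real n) (Suc M) = (\<Prod>j<Suc M. \<alpha> * (\<beta> / \<alpha> + real j * (1 / \<alpha>) + real n))"
          unfolding pochhammer_prod atLeast0LessThan
          by (rule prod.cong) (use pos in \<open>auto simp: field_simps\<close>)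
        then show ?thesis by (simp only: prod.distrib prod_constant card_lessThan)
      qed
      moreover define Q where "Q = (\<Prod>j<Suc M. \<beta> / \<alpha> + real j * (1 / \<alpha>) + real n)"
      moreover have "Q > 0" unfolding Q_def
        by (rule prod_pos) (use pos in \<open>auto intro!: add_pos_nonneg\<close>)
      moreover have "(\<Prod>j<Suc M. (\<beta> / \<alpha> + real j * (1 / \<alpha>) + real n) powr \<gamma>) = Q powr \<gamma>"
        unfolding Q_def by (rule prod_powr_distrib[symmetric])
      moreover have "pochhammer (1 + real n) (Suc k) = (\<Prod>i<Suc k. 1 + real i * 1 + real n)"
        unfolding pochhammer_prod atLeast0LessThan by (rule prod.cong) auto
      moreover have "r M ^ n * exp ((1 + real n) * ln (real k)) =
          exp (ln (real k)) * exp (\<alpha> * real n * ln (real M)) powr \<gamma>"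
        by (simp add: r_def k_def powr_def algebra_simps flip: exp_of_nat_mult exp_add)
      ultimately show ?thesis
        using pos unfolding A_def Gamma_series_def C_def k_def[symmetric]
        by (simp add: powr_divide powr_mult exp_add distrib_right field_simps del: prod.lessThan_Suc)
    qed
    then show ?thesis
      using hausdorff_cmult[OF less_imp_le[OF \<open>C > 0\<close>] hd] by simp
  qed
qed

end

section \<open>Log-convexity of the moments\<close>

lemma egf_neg_antimono:
  assumes a: "entire_seq a" and nonneg: "\<And>x. x > 0 \<Longrightarrow> egf_neg (\<lambda>n. a (Suc n)) x \<ge> 0"
    and "0 \<le> x" "x \<le> y"
  shows "egf_neg a y \<le> egf_neg a x"
proof (cases "x = y")
  case False
  show ?thesis
  proof (rule DERIV_nonpos_imp_decreasing_open[where f = "egf_neg a"])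
    show "x \<le> y" by fact
    show "\<exists>D. (egf_neg a has_real_derivative D) (at t) \<and> D \<le> 0" if "x < t" "t < y" for t
      using DERIV_egf_neg[OF a, of t] nonneg[of t] that \<open>0 \<le> x\<close> by auto
    show "continuous_on {x..y} (egf_neg a)"
      using DERIV_egf_neg[OF a] DERIV_isCont by (blast intro: continuous_at_imp_continuous_on)
  qed
qed simp

text \<open>The Taylor series at \<open>x\<close>, evaluated at \<open>0\<close>. All its terms are nonnegative, which makes it
  a discrete substitute for the representing measure: the weights sit at the points \<open>k / x\<close>.\<close>

lemma egf_neg_Taylor_sums:
  assumes a: "entire_seq a" and nonneg: "\<And>k x. x > 0 \<Longrightarrow> egf_neg (\<lambda>n. a (n + k)) x \<ge> 0"
    and x: "x > 0"
  shows "(\<lambda>k. egf_neg (\<lambda>n. a (n + k)) x / fact k * x ^ k) sums a 0"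
proof -
  define F where "F k u = egf_neg (\<lambda>n. a (n + k)) (x - u)" for k u
  have deriv: "(F k has_real_derivative F (Suc k) u) (at u)" for k u
  proof -
    have "((\<lambda>u. x - u) has_real_derivative - 1) (at u)"
      by (auto intro!: derivative_eq_intros)
    from DERIV_chain'[OF this DERIV_egf_neg[OF entire_seq_shift[OF a, of k]]]
    show ?thesis by (simp add: F_def[abs_def])
  qed
  have "\<bar>(\<Sum>k<n. F k 0 / fact k * x ^ k) - a 0\<bar> \<le> a n / fact n * x ^ n" if n: "n > 0" for n
  proof -
    obtain t where t: "0 < t" "t < x"
      and eq: "F 0 x = (\<Sum>k<n. F k 0 / fact k * x ^ k) + F n t / fact n * x ^ n"
      using Maclaurin[of x n F "F 0", OF x n] deriv by blast
    have "0 \<le> F n t" unfolding F_def using t by (intro nonneg) auto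
    moreover have "F n t \<le> a n"
    proof -
      have "F n t \<le> egf_neg (\<lambda>i. a (i + n)) 0"
        unfolding F_def using t nonneg[of _ "Suc n"]
        by (intro egf_neg_antimono entire_seq_shift a) auto
      then show ?thesis by simp
    qed
    moreover have "F 0 x = a 0" by (simp add: F_def)
    moreover have "F n t / fact n * x ^ n \<le> a n / fact n * x ^ n"
      using \<open>F n t \<le> a n\<close> x by (intro mult_right_mono divide_right_mono) auto
    moreover have "0 \<le> F n t / fact n * x ^ n"
      using \<open>0 \<le> F n t\<close> x by simp
    ultimately show ?thesis
      using eq by linarith
  qed
  then have "eventually (\<lambda>n. norm ((\<Sum>k<n. F k 0 / fact k * x ^ k) - a 0) \<le> a n / fact n * x ^ n) sequentially"
    by (auto intro: eventually_mono[OF eventually_gt_at_top[of 0]])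
  moreover have "(\<lambda>n. a n / fact n * x ^ n) \<longlonglongrightarrow> 0"
    by (intro summable_LIMSEQ_zero entire_seqD a)
  ultimately have "(\<lambda>n. (\<Sum>k<n. F k 0 / fact k * x ^ k) - a 0) \<longlonglongrightarrow> 0"
    by (rule Lim_null_comparison)
  then show ?thesis
    by (simp add: sums_def F_def LIM_zero_cancel)
qed

text \<open>With the weights \<open>P k\<close> of the Taylor series at \<open>x\<close>, the first three coefficients are the factorial
  moments divided by powers of \<open>x\<close>. Nonnegativity of \<open>\<Sum>k. (k - l x)^2 P k\<close> becomes the
  quadratic inequality for the coefficients when \<open>x\<close> tends to infinity, since the difference between ordinary and
  factorial moments is of order \<open>1 / x\<close>.\<close>

lemma completely_monotone_imp_log_convex:
  assumes a: "entire_seq a" and cm: "completely_monotone (egf_neg a)" and a_pos: "\<And>n. a n > 0"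
  shows "a (Suc n) ^ 2 \<le> a n * a (n + 2)"
proof -
  define b where "b k = a (k + n)" for k
  have b: "entire_seq b" unfolding b_def[abs_def] by (rule entire_seq_shift[OF a])
  have nonneg: "egf_neg (\<lambda>i. b (i + k)) x \<ge> 0" if "x > 0" for k x
    using cm that unfolding completely_monotone_egf_neg_iff[OF a] b_def by (simp add: add.assoc)
  \<comment> \<open>The minimiser of the quadratic \<open>b 2 - 2 l b 1 + l^2 b 0\<close> in \<open>l\<close>.\<close>
  define l where "l = b 1 / b 0"
  have quad: "0 \<le> b 2 + b 1 / x - 2 * l * b 1 + l ^ 2 * b 0" if x: "x > 0" for x
  proof -
    define P where "P k = egf_neg (\<lambda>i. b (i + k)) x / fact k * x ^ k" for k
    have P: "P k \<ge> 0" for k unfolding P_def using nonneg[OF x] x by simp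
    have shifted: "(\<lambda>k. egf_neg (\<lambda>i. b (i + (k + j))) x / fact k * x ^ k) sums b j" for j
      using egf_neg_Taylor_sums[OF entire_seq_shift[OF b, of j] _ x] nonneg
      by (simp add: add.assoc add.left_commute[of j] add.commute[of j])
    have 0: "P sums b 0"
      using shifted[of 0] by (simp add: P_def[abs_def])
    have "(\<lambda>k. real (Suc k) * P (Suc k)) sums (x * b 1)"
      using sums_mult[OF shifted[of 1], of x] by (simp add: P_def divide_simps mult_ac del: of_nat_Suc)
    then have 1: "(\<lambda>k. real k * P k) sums (x * b 1)"
      using sums_Suc_iff[of "\<lambda>k. real k * P k"] by simp
    have "(\<lambda>k. real (Suc (Suc k)) * real (Suc k) * P (Suc (Suc k))) sums (x ^ 2 * b 2)"
      using sums_mult[OF shifted[of 2], of "x ^ 2"]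
      by (simp add: P_def divide_simps power2_eq_square mult_ac del: of_nat_Suc)
    then have "(\<lambda>k. real (Suc k) * real k * P (Suc k)) sums (x ^ 2 * b 2)"
      using sums_Suc_iff[of "\<lambda>k. real (Suc k) * real k * P (Suc k)"] by simp
    then have 2: "(\<lambda>k. real k * (real k - 1) * P k) sums (x ^ 2 * b 2)"
      using sums_Suc_iff[of "\<lambda>k. real k * (real k - 1) * P k"] by simp
    have "(\<lambda>k. real k * (real k - 1) * P k + (1 - 2 * (l * x)) * (real k * P k) + (l * x) ^ 2 * P k)
        sums (x ^ 2 * b 2 + (1 - 2 * (l * x)) * (x * b 1) + (l * x) ^ 2 * b 0)"
      by (intro sums_add sums_mult 0 1 2)
    moreover have "real k * (real k - 1) * P k + (1 - 2 * (l * x)) * (real k * P k) + (l * x) ^ 2 * P k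
        = (real k - l * x) ^ 2 * P k" for k
      by (simp add: power2_eq_square algebra_simps)
    ultimately have "(\<lambda>k. (real k - l * x) ^ 2 * P k)
        sums (x ^ 2 * b 2 + (1 - 2 * (l * x)) * (x * b 1) + (l * x) ^ 2 * b 0)"
      by (simp only:)
    then have "0 \<le> x ^ 2 * b 2 + (1 - 2 * (l * x)) * (x * b 1) + (l * x) ^ 2 * b 0"
      by (rule sums_le[OF _ sums_zero, rotated]) (simp add: P)
    also have "\<dots> = x ^ 2 * (b 2 + b 1 / x - 2 * l * b 1 + l ^ 2 * b 0)"
      using x by (simp add: power2_eq_square field_simps)
    finally show ?thesis using x by (simp add: zero_le_mult_iff)
  qed
  have "((\<lambda>x. b 2 + b 1 / x - 2 * l * b 1 + l ^ 2 * b 0) \<longlongrightarrow> b 2 + 0 - 2 * l * b 1 + l ^ 2 * b 0) at_top"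
    by (intro tendsto_intros tendsto_divide_0[OF tendsto_const]) (auto intro: filterlim_at_top_imp_at_infinity filterlim_ident)
  then have "0 \<le> b 2 + 0 - 2 * l * b 1 + l ^ 2 * b 0"
    by (rule tendsto_lowerbound[OF _ eventually_mono[OF eventually_gt_at_top[of 0] quad]]) auto
  then have "b 1 ^ 2 \<le> b 0 * b 2"
    using a_pos[of n] unfolding l_def
    by (simp add: b_def power2_eq_square field_simps)
  then show ?thesis by (simp add: b_def add.commute)
qed

section \<open>Necessary conditions from the growth of the moments\<close>

lemma ratio_le_ratio:
  fixes p q r :: real
  assumes "0 < p" "0 < q" "q ^ 2 \<le> p * r"
  shows "q / p \<le> r / q"
  using assms by (simp add: divide_simps power2_eq_square mult.commute)

text \<open>As \<open>\<Gamma>(z + \<alpha>) / \<Gamma>(z) = (z + (\<alpha> - 1)/2 + o(1))^\<alpha>\<close>, the threshold for \<open>c\<close> is sharp. Kershaw's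
  argument: the logarithm \<open>h\<close> of the quotient of both sides increases along \<open>z, z + 1, ...\<close> once \<open>z\<close>
  is large, by an elementary expansion of \<open>h (z + 1) - h z\<close>, and tends to \<open>0\<close>; hence \<open>h z \<le> 0\<close>.\<close>

lemma Gamma_ratio_upper_bound:
  fixes \<alpha> c :: real
  assumes "\<alpha> > 0" and c: "c > (\<alpha> - 1) / 2"
  shows "eventually (\<lambda>z. Gamma (z + \<alpha>) \<le> (z + c) powr \<alpha> * Gamma z) at_top"
proof -
  define h where "h z = ln (Gamma (z + \<alpha>)) - ln (Gamma z) - \<alpha> * ln (z + c)" for z
  define d where "d z = ln (z + \<alpha>) - ln z - \<alpha> * (ln (z + 1 + c) - ln (z + c))" for z
  have "((\<lambda>z. z ^ 2 * d z) \<longlongrightarrow> \<alpha> * (c - (\<alpha> - 1) / 2)) at_top"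
    unfolding d_def using \<open>\<alpha> > 0\<close> by (real_asymp simp: field_simps)
  moreover have "\<alpha> * (c - (\<alpha> - 1) / 2) > 0" using assms by simp
  ultimately have "eventually (\<lambda>z. z ^ 2 * d z > 0) at_top"
    by (rule order_tendstoD)
  then obtain Z where Z: "\<And>z. z \<ge> Z \<Longrightarrow> z ^ 2 * d z > 0"
    by (auto simp: eventually_at_top_linorder)
  have "Gamma (z + \<alpha>) \<le> (z + c) powr \<alpha> * Gamma z" if z: "z \<ge> max Z (max 2 (1 - c))" for z
  proof -
    have mono: "h (z + real k) \<le> h (z + real (Suc k))" for k
    proof -
      define y where "y = z + real k"
      have y: "y \<ge> Z" "y > 0" using z by (auto simp: y_def)
      have "h (y + 1) - h y = d y"
        unfolding h_def d_def using ln_Gamma_plus1_pos[of y] ln_Gamma_plus1_pos[of "y + \<alpha>"] y \<open>\<alpha> > 0\<close>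
        by (simp add: algebra_simps)
      moreover have "d y > 0" using Z[OF y(1)] y(2) by (simp add: zero_less_mult_iff)
      ultimately show ?thesis by (simp add: y_def algebra_simps)
    qed
    have up: "h (z + real k) \<le> \<alpha> * ln (z + real k + \<alpha>) - \<alpha> * ln (z + real k + c)" for k
    proof -
      define y where "y = z + real k"
      have y: "y > 1" using z by (auto simp: y_def)
      have G: "Gamma y > 0" "Gamma (y + \<alpha>) > 0" using y \<open>\<alpha> > 0\<close> by (auto intro!: Gamma_real_pos)
      have "ln (Gamma (y + \<alpha>)) \<le> ln ((y + \<alpha>) powr \<alpha> * Gamma y)"
        using Gamma_add_bounds(2)[OF y \<open>\<alpha> > 0\<close>] G by simp
      also have "\<dots> = \<alpha> * ln (y + \<alpha>) + ln (Gamma y)"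
        using G y \<open>\<alpha> > 0\<close> by (subst ln_mult) (auto simp: less_imp_neq[THEN not_sym])
      finally show ?thesis by (simp add: h_def y_def)
    qed
    have "h z \<le> h (z + real k)" for k
    proof (induction k)
      case (Suc k)
      with mono[of k] show ?case by linarith
    qed simp
    with up have "h z \<le> \<alpha> * ln (z + real k + \<alpha>) - \<alpha> * ln (z + real k + c)" for k
      using order_trans by blast
    moreover have "(\<lambda>k. \<alpha> * ln (z + real k + \<alpha>) - \<alpha> * ln (z + real k + c)) \<longlonglongrightarrow> 0"
      by real_asymp
    ultimately have "h z \<le> 0"
      by (auto intro: LIMSEQ_le_const)
    moreover have G: "Gamma z > 0" "Gamma (z + \<alpha>) > 0" "z + c > 0"
      using z \<open>\<alpha> > 0\<close> by (auto intro!: Gamma_real_pos)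
    ultimately have "ln (Gamma (z + \<alpha>)) \<le> \<alpha> * ln (z + c) + ln (Gamma z)"
      by (simp add: h_def)
    then have "exp (ln (Gamma (z + \<alpha>))) \<le> exp (\<alpha> * ln (z + c) + ln (Gamma z))"
      by (simp only: exp_le_cancel_iff)
    then show ?thesis using G by (simp add: exp_add powr_def)
  qed
  then show ?thesis unfolding eventually_at_top_linorder by blast
qed

context
  fixes \<alpha> \<beta> \<gamma> :: real
  assumes pos: "\<alpha> > 0" "\<beta> > 0" "\<gamma> > 0"
    and cm: "completely_monotone (le_roy_neg \<alpha> \<beta> \<gamma>)"
begin

lemma moment_ratio_mono:
  "incseq (\<lambda>n. le_roy_moment \<alpha> \<beta> \<gamma> (Suc n) / le_roy_moment \<alpha> \<beta> \<gamma> n)"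
  unfolding incseq_Suc_iff
proof
  fix n
  let ?a = "le_roy_moment \<alpha> \<beta> \<gamma>"
  have "completely_monotone (egf_neg ?a)"
    using cm by (simp only: le_roy_neg_eq_egf_neg[OF pos])
  from completely_monotone_imp_log_convex[OF le_roy_moment_entire[OF pos] this le_roy_moment_pos[OF pos], of n]
  have "?a (Suc n) ^ 2 \<le> ?a n * ?a (Suc (Suc n))" by (simp only: add_2_eq_Suc')
  from ratio_le_ratio[OF le_roy_moment_pos[OF pos] le_roy_moment_pos[OF pos] this]
  show "?a (Suc n) / ?a n \<le> ?a (Suc (Suc n)) / ?a (Suc n)" .
qed

lemma moment_ratio_eq:
  "le_roy_moment \<alpha> \<beta> \<gamma> (Suc n) / le_roy_moment \<alpha> \<beta> \<gamma> n =
    real (Suc n) * (Gamma (\<beta> + \<alpha> * real n) / Gamma (\<beta> + \<alpha> * real n + \<alpha>)) powr \<gamma>"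
proof -
  have arg: "\<beta> + \<alpha> * real (Suc n) = \<beta> + \<alpha> * real n + \<alpha>" by (simp add: algebra_simps)
  show ?thesis
    using Gamma_arg_pos[OF pos, of n] Gamma_arg_pos[OF pos, of "Suc n"]
    unfolding le_roy_moment_def arg fact_Suc by (simp add: powr_divide)
qed

lemma moment_ratio_le_limit:
  assumes "(\<lambda>n. real (Suc n) / (\<beta> + \<alpha> * real n - 1) powr (\<alpha> * \<gamma>)) \<longlonglongrightarrow> c"
  shows "le_roy_moment \<alpha> \<beta> \<gamma> (Suc n) / le_roy_moment \<alpha> \<beta> \<gamma> n \<le> c"
proof (rule LIMSEQ_le_const[OF assms])
  have "eventually (\<lambda>k. \<beta> + \<alpha> * real k > 1) sequentially"
    using pos by real_asymp
  then obtain N where N: "\<And>k. k \<ge> N \<Longrightarrow> \<beta> + \<alpha> * real k > 1"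
    by (auto simp: eventually_sequentially)
  have "le_roy_moment \<alpha> \<beta> \<gamma> (Suc n) / le_roy_moment \<alpha> \<beta> \<gamma> n
      \<le> real (Suc k) / (\<beta> + \<alpha> * real k - 1) powr (\<alpha> * \<gamma>)" if "k \<ge> max n N" for k
  proof -
    define z where "z = \<beta> + \<alpha> * real k"
    have z: "z > 1" using N that by (simp add: z_def)
    have G: "Gamma z > 0" "Gamma (z + \<alpha>) > 0" using z pos by (auto intro!: Gamma_real_pos)
    have "le_roy_moment \<alpha> \<beta> \<gamma> (Suc n) / le_roy_moment \<alpha> \<beta> \<gamma> n
        \<le> le_roy_moment \<alpha> \<beta> \<gamma> (Suc k) / le_roy_moment \<alpha> \<beta> \<gamma> k"
      using incseqD[OF moment_ratio_mono, of n k] that by simp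
    also have "\<dots> = real (Suc k) * (Gamma z / Gamma (z + \<alpha>)) powr \<gamma>"
      by (simp only: moment_ratio_eq z_def)
    also have "\<dots> \<le> real (Suc k) * (1 / (z - 1) powr \<alpha>) powr \<gamma>"
      using Gamma_add_bounds(1)[OF z pos(1)] G z pos
      by (intro mult_left_mono powr_mono2) (auto simp: field_simps)
    also have "\<dots> = real (Suc k) / (z - 1) powr (\<alpha> * \<gamma>)"
      using z by (simp add: powr_divide powr_powr)
    finally show ?thesis by (simp only: z_def)
  qed
  then show "\<exists>N. \<forall>k\<ge>N. le_roy_moment \<alpha> \<beta> \<gamma> (Suc n) / le_roy_moment \<alpha> \<beta> \<gamma> n
      \<le> real (Suc k) / (\<beta> + \<alpha> * real k - 1) powr (\<alpha> * \<gamma>)"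
    by (intro exI[of _ "max n N"] allI impI)
qed

lemma alpha_gamma_le_1: "\<alpha> * \<gamma> \<le> 1"
proof (rule ccontr)
  assume "\<not> \<alpha> * \<gamma> \<le> 1"
  then have p: "\<alpha> * \<gamma> > 1" by simp
  have "(\<lambda>n. real (Suc n) / (\<beta> + \<alpha> * real n - 1) powr p) \<longlonglongrightarrow> 0" if "p > 1" for p
    using pos(1) that by real_asymp
  from moment_ratio_le_limit[OF this[OF p], of 0] show False
    using le_roy_moment_pos[OF pos, of 0] le_roy_moment_pos[OF pos, of 1]
    by (simp add: divide_le_0_iff)
qed

lemma beta_ge_critical:
  assumes "\<alpha> * \<gamma> = 1"
  shows "\<beta> \<ge> (1 + \<alpha>) / 2"
proof (rule ccontr)
  assume "\<not> \<beta> \<ge> (1 + \<alpha>) / 2"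
  \<comment> \<open>Halfway between \<open>(\<alpha> - 1) / 2\<close>, above which the bound on the Gamma ratio holds, and
    \<open>\<alpha> - \<beta>\<close>, below which it contradicts the bound \<open>1 / \<alpha>\<close> on the moment ratio.\<close>
  define c where "c = ((\<alpha> - \<beta>) + (\<alpha> - 1) / 2) / 2"
  have c: "c > (\<alpha> - 1) / 2" "\<beta> + c < \<alpha>"
    using \<open>\<not> \<beta> \<ge> (1 + \<alpha>) / 2\<close> by (simp_all add: c_def field_simps)
  have "filterlim (\<lambda>n. \<beta> + \<alpha> * real n) at_top sequentially"
    using pos by real_asymp
  moreover have "eventually (\<lambda>z. Gamma (z + \<alpha>) \<le> (z + c) powr \<alpha> * Gamma z \<and> z + c > 0) at_top"
    by (intro eventually_conj Gamma_ratio_upper_bound pos c) real_asymp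
  ultimately have "eventually (\<lambda>n. Gamma (\<beta> + \<alpha> * real n + \<alpha>) \<le>
      (\<beta> + \<alpha> * real n + c) powr \<alpha> * Gamma (\<beta> + \<alpha> * real n) \<and> \<beta> + \<alpha> * real n + c > 0) sequentially"
    by (rule eventually_compose_filterlim[rotated])
  then obtain n where n: "Gamma (\<beta> + \<alpha> * real n + \<alpha>) \<le>
      (\<beta> + \<alpha> * real n + c) powr \<alpha> * Gamma (\<beta> + \<alpha> * real n)" "\<beta> + \<alpha> * real n + c > 0"
    by (auto simp: eventually_sequentially)
  define z where "z = \<beta> + \<alpha> * real n"
  have "z > 0" using pos unfolding z_def by (intro add_pos_nonneg) auto
  then have G: "Gamma z > 0" "Gamma (z + \<alpha>) > 0"
    using pos by (auto intro!: Gamma_real_pos)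
  have "(\<lambda>n. real (Suc n) / (\<beta> + \<alpha> * real n - 1) powr (\<alpha> * \<gamma>)) \<longlonglongrightarrow> 1 / \<alpha>"
    unfolding assms using pos by (real_asymp simp: field_simps)
  from moment_ratio_le_limit[OF this, of n]
  have "real (Suc n) * (Gamma z / Gamma (z + \<alpha>)) powr \<gamma> \<le> 1 / \<alpha>"
    by (simp only: moment_ratio_eq z_def)
  moreover have "1 / (z + c) = (1 / (z + c) powr \<alpha>) powr \<gamma>"
    using n(2) assms by (simp add: powr_divide powr_powr z_def)
  moreover have "(1 / (z + c) powr \<alpha>) powr \<gamma> \<le> (Gamma z / Gamma (z + \<alpha>)) powr \<gamma>"
    using n G pos by (intro powr_mono2) (auto simp: z_def field_simps)
  ultimately have "real (Suc n) * (1 / (z + c)) \<le> 1 / \<alpha>"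
    by (smt (verit) mult_left_mono of_nat_0_le_iff)
  then have "\<alpha> * real (Suc n) \<le> z + c"
    using n(2) pos by (simp add: z_def field_simps)
  with c(2) show False by (simp add: z_def algebra_simps)
qed

end

section \<open>Raising the second parameter by one\<close>

lemma has_bochner_integral_Gamma_kernel:
  fixes p s :: real
  assumes "p > 0" "s > 0"
  shows "has_bochner_integral lborel (\<lambda>t. indicator {0..} t * t powr (p - 1) * exp (- s * t)) (Gamma p / s powr p)"
proof -
  define f where "f t = indicator {0..} t * t powr (p - 1) / exp t" for t :: real
  have "has_bochner_integral lborel f (Gamma p)"
  proof (rule has_bochner_integral_nn_integral)
    show "(\<integral>\<^sup>+ t. ennreal (f t) \<partial>lborel) = ennreal (Gamma p)"
      using Gamma_conv_nn_integral_real[OF assms(1)] by (simp add: f_def)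
    show "f \<in> borel_measurable lborel" unfolding f_def[abs_def] by measurable
  qed (use assms in \<open>auto simp: f_def\<close>)
  then have "has_bochner_integral lborel (\<lambda>t. f (0 + s * t)) (Gamma p /\<^sub>R \<bar>s\<bar>)"
    using assms by (subst (asm) lborel_has_bochner_integral_real_affine_iff[of s _ _ 0]) auto
  then have "has_bochner_integral lborel (\<lambda>t. s powr (1 - p) * f (0 + s * t)) (s powr (1 - p) * (Gamma p /\<^sub>R \<bar>s\<bar>))"
    by (rule has_bochner_integral_mult_right)
  moreover have "s powr (1 - p) * f (0 + s * t) = indicator {0..} t * t powr (p - 1) * exp (- s * t)" for t
  proof (cases "t \<ge> 0")
    case True
    have "s powr (1 - p) * s powr (p - 1) = 1"
      using assms by (simp flip: powr_add)
    then show ?thesis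
      using True assms by (simp add: f_def powr_mult exp_minus divide_inverse)
  qed (use assms in \<open>simp add: f_def zero_le_mult_iff\<close>)
  moreover have "s powr (1 - p) * (Gamma p /\<^sub>R \<bar>s\<bar>) = Gamma p / s powr p"
    using assms by (simp add: powr_diff divide_simps)
  ultimately show ?thesis by simp
qed

text \<open>One bound for both signs of the exponent.\<close>

lemma powr_lower_bound:
  fixes s t p :: real
  assumes "0 < s" "s \<le> t" "t \<le> 2 * s"
  shows "min 1 (2 powr p) * s powr p \<le> t powr p"
proof (cases "p \<ge> 0")
  case True
  have "min 1 (2 powr p) * s powr p \<le> 1 * s powr p"
    by (intro mult_right_mono) auto
  also have "\<dots> \<le> t powr p" using assms True by (simp add: powr_mono2)
  finally show ?thesis .
next
  case False
  have "min 1 (2 powr p) * s powr p \<le> 2 powr p * s powr p"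
    by (intro mult_right_mono) auto
  also have "\<dots> = (2 * s) powr p" using assms by (simp add: powr_mult)
  also have "\<dots> \<le> t powr p" using assms False by (intro powr_mono2') auto
  finally show ?thesis .
qed

context
  fixes \<alpha> \<gamma> :: real
  assumes pos: "\<alpha> > 0" "\<gamma> > 0"
begin

text \<open>Integration of the series term by term. The kernel turns \<open>exp (-t) ^ n\<close> into a multiple
  of \<open>(\<beta>/\<alpha> + n)^(-\<gamma>)\<close>, and \<open>(\<beta> + \<alpha> n) \<Gamma>(\<beta> + \<alpha> n) = \<Gamma>(\<beta> + 1 + \<alpha> n)\<close>.\<close>

lemma le_roy_raise_integral:
  assumes "\<beta> > 0"
  shows "has_bochner_integral lborel
    (\<lambda>t. indicator {0..} t * t powr (\<gamma> - 1) * exp (- (\<beta> / \<alpha>) * t) * le_roy_neg \<alpha> \<beta> \<gamma> (x * exp (- t)))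
    (Gamma \<gamma> * \<alpha> powr \<gamma> * le_roy_neg \<alpha> (\<beta> + 1) \<gamma> x)"
proof -
  note pos' = pos(1) \<open>\<beta> > 0\<close> pos(2)
  have pos'': "\<alpha> > 0" "\<beta> + 1 > 0" "\<gamma> > 0" using pos' by auto
  define g where "g s t = indicator {0..} t * t powr (\<gamma> - 1) * exp (- s * t)" for s t :: real
  define b where "b n = le_roy_moment \<alpha> \<beta> \<gamma> n / fact n * (- x) ^ n" for n
  define b' where "b' n = le_roy_moment \<alpha> (\<beta> + 1) \<gamma> n / fact n * (- x) ^ n" for n
  have g_nonneg: "g s t \<ge> 0" for s t by (simp add: g_def)
  have g_split: "g (\<beta> / \<alpha> + real n) t = g (\<beta> / \<alpha>) t * exp (- t) ^ n" for n t
    by (simp add: g_def distrib_right exp_add flip: exp_of_nat_mult) (simp add: exp_diff exp_minus field_simps)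
  have g_int: "has_bochner_integral lborel (g (\<beta> / \<alpha> + real n)) (Gamma \<gamma> / (\<beta> / \<alpha> + real n) powr \<gamma>)" for n
    unfolding g_def using pos' by (intro has_bochner_integral_Gamma_kernel) (auto intro!: add_pos_nonneg)
  have b': "b n * (Gamma \<gamma> / (\<beta> / \<alpha> + real n) powr \<gamma>) = Gamma \<gamma> * \<alpha> powr \<gamma> * b' n" for n
  proof -
    define z where "z = \<beta> + \<alpha> * real n"
    have z: "z > 0" using pos' by (auto simp: z_def intro!: add_pos_nonneg)
    note Gamma_plus1_pos[OF z]
    then have "Gamma (\<beta> + 1 + \<alpha> * real n) = z * Gamma z"
      by (simp add: z_def algebra_simps)
    moreover have "\<beta> / \<alpha> + real n = z / \<alpha>"
      using pos' by (simp add: z_def field_simps)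
    ultimately show ?thesis
      using pos' unfolding b_def b'_def le_roy_moment_def z_def[symmetric]
      by (simp add: powr_mult powr_divide mult_ac)
  qed
  have sums_b: "summable (\<lambda>n. \<bar>b n\<bar>)"
    using entire_seqD[OF le_roy_moment_entire[OF pos'], of "\<bar>x\<bar>"] le_roy_moment_pos[OF pos']
    by (simp add: b_def abs_mult power_abs less_imp_le)
  have sums_b': "summable (\<lambda>n. \<bar>b' n\<bar>)"
    using entire_seqD[OF le_roy_moment_entire[OF pos''], of "\<bar>x\<bar>"] le_roy_moment_pos[OF pos'']
    by (simp add: b'_def abs_mult power_abs less_imp_le)
  have term_int: "has_bochner_integral lborel (\<lambda>t. b n * g (\<beta> / \<alpha> + real n) t) (Gamma \<gamma> * \<alpha> powr \<gamma> * b' n)" for n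
    using has_bochner_integral_mult_right[OF g_int, of "b n" n] unfolding b' .
  have norm_int: "(LINT t|lborel. norm (b n * g (\<beta> / \<alpha> + real n) t)) = Gamma \<gamma> * \<alpha> powr \<gamma> * \<bar>b' n\<bar>" for n
  proof -
    have "has_bochner_integral lborel (\<lambda>t. \<bar>b n\<bar> * g (\<beta> / \<alpha> + real n) t)
        (\<bar>b n\<bar> * (Gamma \<gamma> / (\<beta> / \<alpha> + real n) powr \<gamma>))"
      by (intro has_bochner_integral_mult_right g_int)
    moreover have "\<bar>b n\<bar> * (Gamma \<gamma> / (\<beta> / \<alpha> + real n) powr \<gamma>) = Gamma \<gamma> * \<alpha> powr \<gamma> * \<bar>b' n\<bar>"
      using arg_cong[OF b'[of n], of abs] pos Gamma_real_pos[of \<gamma>] by (simp add: abs_mult)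
    ultimately show ?thesis
      by (simp add: has_bochner_integral_iff abs_mult g_nonneg)
  qed
  have 1: "integrable lborel (\<lambda>t. b n * g (\<beta> / \<alpha> + real n) t)" for n
    using term_int by (simp add: has_bochner_integral_iff)
  have 2: "AE t in lborel. summable (\<lambda>n. norm (b n * g (\<beta> / \<alpha> + real n) t))"
  proof (rule AE_I2)
    fix t :: real
    show "summable (\<lambda>n. norm (b n * g (\<beta> / \<alpha> + real n) t))"
    proof (rule summable_comparison_test')
      show "summable (\<lambda>n. \<bar>b n\<bar> * g (\<beta> / \<alpha>) t)"
        using sums_b by (rule summable_mult2)
      show "norm (norm (b n * g (\<beta> / \<alpha> + real n) t)) \<le> \<bar>b n\<bar> * g (\<beta> / \<alpha>) t" if "n \<ge> 0" for n
      proof -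
        have "g (\<beta> / \<alpha> + real n) t \<le> g (\<beta> / \<alpha>) t"
        proof (cases "t \<ge> 0")
          case True
          then have "exp (- t) ^ n \<le> 1" by (intro power_le_one) auto
          then show ?thesis
            unfolding g_split using g_nonneg[of "\<beta> / \<alpha>" t] by (simp add: mult_left_le)
        qed (simp add: g_def)
        then show ?thesis
          using g_nonneg[of "\<beta> / \<alpha> + real n" t] by (simp add: abs_mult mult_left_mono)
      qed
    qed
  qed
  have 3: "summable (\<lambda>n. LINT t|lborel. norm (b n * g (\<beta> / \<alpha> + real n) t))"
    unfolding norm_int using sums_b' by (rule summable_mult)
  have "has_bochner_integral lborel (\<lambda>t. \<Sum>n. b n * g (\<beta> / \<alpha> + real n) t) (\<Sum>n. Gamma \<gamma> * \<alpha> powr \<gamma> * b' n)"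
    using integrable_suminf[OF 1 2 3] integral_suminf[OF 1 2 3] term_int
    by (simp add: has_bochner_integral_iff)
  moreover have "(\<Sum>n. b n * g (\<beta> / \<alpha> + real n) t) =
      indicator {0..} t * t powr (\<gamma> - 1) * exp (- (\<beta> / \<alpha>) * t) * le_roy_neg \<alpha> \<beta> \<gamma> (x * exp (- t))" for t
  proof -
    have "(\<Sum>n. b n * g (\<beta> / \<alpha> + real n) t) =
        (\<Sum>n. g (\<beta> / \<alpha>) t * (le_roy_moment \<alpha> \<beta> \<gamma> n / fact n * (- (x * exp (- t))) ^ n))"
      unfolding g_split b_def minus_mult_left power_mult_distrib by (simp add: mult_ac)
    also have "\<dots> = g (\<beta> / \<alpha>) t * le_roy_neg \<alpha> \<beta> \<gamma> (x * exp (- t))"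
      unfolding le_roy_neg_eq_egf_neg[OF pos'] egf_neg_def
      by (intro suminf_mult entire_seqD le_roy_moment_entire pos')
    finally show ?thesis by (simp add: g_def)
  qed
  moreover have "(\<Sum>n. Gamma \<gamma> * \<alpha> powr \<gamma> * b' n) = Gamma \<gamma> * \<alpha> powr \<gamma> * le_roy_neg \<alpha> (\<beta> + 1) \<gamma> x"
    unfolding le_roy_neg_eq_egf_neg[OF pos''] egf_neg_def b'_def
    by (intro suminf_mult entire_seqD le_roy_moment_entire pos'')
  ultimately show ?thesis by simp
qed

lemma le_roy_raise_nonneg:
  assumes "\<beta> > 0" and nonneg: "\<And>x. x > 0 \<Longrightarrow> le_roy_neg \<alpha> \<beta> \<gamma> x \<ge> 0" and "x > 0"
  shows "le_roy_neg \<alpha> (\<beta> + 1) \<gamma> x \<ge> 0"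
proof -
  have "0 \<le> Gamma \<gamma> * \<alpha> powr \<gamma> * le_roy_neg \<alpha> (\<beta> + 1) \<gamma> x"
    unfolding has_bochner_integral_integral_eq[OF le_roy_raise_integral[OF assms(1)], symmetric]
    using nonneg \<open>x > 0\<close> by (intro integral_nonneg_AE AE_I2 mult_nonneg_nonneg) auto
  moreover have "Gamma \<gamma> * \<alpha> powr \<gamma> > 0" using pos by (intro mult_pos_pos) auto
  ultimately show ?thesis
    using mult_le_cancel_left_pos[of "Gamma \<gamma> * \<alpha> powr \<gamma>" 0] by simp
qed

text \<open>Only the part of the integral over \<open>[L, L + 1]\<close> is kept. The constant \<open>K\<close> does not depend on \<open>x\<close>,
  \<open>L\<close> and \<open>m\<close>: a large \<open>L\<close> transports values near \<open>0\<close> to large arguments, while \<open>L = 1\<close> transports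
  a lower bound at infinity from one second parameter to the next.\<close>

lemma le_roy_raise_lower_bound:
  assumes "\<beta> > 0"
  obtains K where "K > 0"
    "\<And>x L m. \<lbrakk>x > 0; L \<ge> 1; m \<ge> 0; \<And>x. x > 0 \<Longrightarrow> le_roy_neg \<alpha> \<beta> \<gamma> x \<ge> 0;
       \<And>t. L \<le> t \<Longrightarrow> t \<le> L + 1 \<Longrightarrow> le_roy_neg \<alpha> \<beta> \<gamma> (x * exp (- t)) \<ge> m\<rbrakk>
      \<Longrightarrow> K * m * L powr (\<gamma> - 1) * exp (- (\<beta> / \<alpha>) * L) \<le> le_roy_neg \<alpha> (\<beta> + 1) \<gamma> x"
proof
  define c where "c = min 1 (2 powr (\<gamma> - 1)) * exp (- (\<beta> / \<alpha>))"
  define G where "G = Gamma \<gamma> * \<alpha> powr \<gamma>"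
  have c: "c > 0" by (simp add: c_def)
  have G: "G > 0" using pos by (simp add: G_def Gamma_real_pos)
  show "c / G > 0" using c G by simp
  fix x L m :: real
  assume x: "x > 0" and L: "L \<ge> 1" and m: "m \<ge> 0"
    and nonneg: "\<And>x. x > 0 \<Longrightarrow> le_roy_neg \<alpha> \<beta> \<gamma> x \<ge> 0"
    and low: "\<And>t. L \<le> t \<Longrightarrow> t \<le> L + 1 \<Longrightarrow> le_roy_neg \<alpha> \<beta> \<gamma> (x * exp (- t)) \<ge> m"
  define k where "k = c * L powr (\<gamma> - 1) * exp (- (\<beta> / \<alpha>) * L) * m"
  let ?f = "\<lambda>t. indicator {0..} t * t powr (\<gamma> - 1) * exp (- (\<beta> / \<alpha>) * t) * le_roy_neg \<alpha> \<beta> \<gamma> (x * exp (- t))"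
  have int: "has_bochner_integral lborel (\<lambda>t. k * indicator {L..L+1} t) (k * 1)"
    using has_bochner_integral_real_indicator[of "{L..L+1}" lborel]
    by (intro has_bochner_integral_mult_right) simp
  have "(LINT t|lborel. k * indicator {L..L+1} t) \<le> (LINT t|lborel. ?f t)"
  proof (rule integral_mono)
    show "integrable lborel (\<lambda>t. k * indicator {L..L+1} t)" "integrable lborel ?f"
      using int le_roy_raise_integral[OF assms] by (simp_all add: has_bochner_integral_iff)
    fix t :: real
    show "k * indicator {L..L+1} t \<le> ?f t"
    proof (cases "L \<le> t \<and> t \<le> L + 1")
      case True
      have "min 1 (2 powr (\<gamma> - 1)) * L powr (\<gamma> - 1) \<le> t powr (\<gamma> - 1)"
        using True L by (intro powr_lower_bound) auto
      moreover have "exp (- (\<beta> / \<alpha>)) * exp (- (\<beta> / \<alpha>) * L) \<le> exp (- (\<beta> / \<alpha>) * t)"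
      proof -
        have "\<beta> / \<alpha> * t \<le> \<beta> / \<alpha> * (L + 1)"
          using True assms pos by (intro mult_left_mono) auto
        then show ?thesis by (simp add: algebra_simps add_divide_distrib flip: exp_add)
      qed
      ultimately have "(min 1 (2 powr (\<gamma> - 1)) * L powr (\<gamma> - 1)) *
            (exp (- (\<beta> / \<alpha>)) * exp (- (\<beta> / \<alpha>) * L)) * m
          \<le> t powr (\<gamma> - 1) * exp (- (\<beta> / \<alpha>) * t) * le_roy_neg \<alpha> \<beta> \<gamma> (x * exp (- t))"
        using low[of t] True m by (intro mult_mono) auto
      then show ?thesis using True L by (simp add: k_def c_def mult_ac)
    next
      case False
      then show ?thesis using nonneg[of "x * exp (- t)"] x by (auto simp: indicator_def)
    qed
  qed
  then have "k \<le> G * le_roy_neg \<alpha> (\<beta> + 1) \<gamma> x"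
    using int le_roy_raise_integral[OF assms, of x] by (simp add: has_bochner_integral_iff G_def)
  then show "c / G * m * L powr (\<gamma> - 1) * exp (- (\<beta> / \<alpha>) * L) \<le> le_roy_neg \<alpha> (\<beta> + 1) \<gamma> x"
    using G by (simp add: k_def field_simps)
qed

end

section \<open>Necessary conditions from the behaviour at infinity\<close>

context
  fixes \<alpha> \<gamma> :: real
  assumes pos: "\<alpha> > 0" "\<gamma> > 0"
begin

text \<open>An index shift in the series. Nonnegativity of the left-hand side bounds the function for \<open>\<beta>\<close>
  by a multiple of \<open>1 / x\<close>.\<close>

lemma le_roy_lower_index:
  assumes "\<beta> > \<alpha>"
  shows "le_roy_neg \<alpha> (\<beta> - \<alpha>) \<gamma> x = 1 / Gamma (\<beta> - \<alpha>) powr \<gamma> - x * le_roy_neg \<alpha> \<beta> \<gamma> x"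
proof -
  have p: "\<beta> > 0" "\<beta> - \<alpha> > 0" using assms pos by auto
  note ent = entire_seqD[OF le_roy_moment_entire[OF pos(1) p(1) pos(2)]]
    entire_seqD[OF le_roy_moment_entire[OF pos(1) p(2) pos(2)]]
  have "le_roy_neg \<alpha> (\<beta> - \<alpha>) \<gamma> x =
      (\<Sum>n. le_roy_moment \<alpha> (\<beta> - \<alpha>) \<gamma> (Suc n) / fact (Suc n) * (- x) ^ Suc n) + 1 / Gamma (\<beta> - \<alpha>) powr \<gamma>"
    unfolding le_roy_neg_eq_egf_neg[OF pos(1) p(2) pos(2)] egf_neg_def
    by (subst suminf_split_head[OF ent(2)]) (simp add: le_roy_moment_def)
  also have "(\<lambda>n. le_roy_moment \<alpha> (\<beta> - \<alpha>) \<gamma> (Suc n) / fact (Suc n) * (- x) ^ Suc n) =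
      (\<lambda>n. - x * (le_roy_moment \<alpha> \<beta> \<gamma> n / fact n * (- x) ^ n))"
  proof
    fix n
    have arg: "\<beta> - \<alpha> + \<alpha> * real (Suc n) = \<beta> + \<alpha> * real n" by (simp add: algebra_simps)
    show "le_roy_moment \<alpha> (\<beta> - \<alpha>) \<gamma> (Suc n) / fact (Suc n) * (- x) ^ Suc n =
        - x * (le_roy_moment \<alpha> \<beta> \<gamma> n / fact n * (- x) ^ n)"
      unfolding le_roy_moment_def arg by (simp del: fact_Suc)
  qed
  also have "(\<Sum>n. - x * (le_roy_moment \<alpha> \<beta> \<gamma> n / fact n * (- x) ^ n)) = - x * le_roy_neg \<alpha> \<beta> \<gamma> x"
    unfolding le_roy_neg_eq_egf_neg[OF pos(1) p(1) pos(2)] egf_neg_def by (rule suminf_mult[OF ent(1)])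
  finally show ?thesis by simp
qed

lemma le_roy_lower_bound_near_0:
  assumes "\<beta> > 0"
  obtains x0 c0 where "x0 > 0" "c0 > 0" "\<And>x. \<lbrakk>0 \<le> x; x \<le> x0\<rbrakk> \<Longrightarrow> c0 \<le> le_roy_neg \<alpha> \<beta> \<gamma> x"
proof -
  note p = pos(1) assms pos(2)
  define c where "c = le_roy_moment \<alpha> \<beta> \<gamma> 0"
  have c: "c > 0" unfolding c_def by (rule le_roy_moment_pos[OF p])
  have "isCont (le_roy_neg \<alpha> \<beta> \<gamma>) 0"
    unfolding le_roy_neg_eq_egf_neg[OF p] using DERIV_egf_neg[OF le_roy_moment_entire[OF p]] DERIV_isCont by blast
  moreover have "le_roy_neg \<alpha> \<beta> \<gamma> 0 = c"
    by (simp add: le_roy_neg_eq_egf_neg[OF p] c_def)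
  ultimately have "le_roy_neg \<alpha> \<beta> \<gamma> \<midarrow>0\<rightarrow> c" by (simp add: isCont_def)
  then have "eventually (\<lambda>x. c / 2 < le_roy_neg \<alpha> \<beta> \<gamma> x) (at 0)"
    using c by (intro order_tendstoD) auto
  then obtain d where d: "d > 0" "\<And>x. \<lbrakk>x \<noteq> 0; dist x 0 < d\<rbrakk> \<Longrightarrow> c / 2 < le_roy_neg \<alpha> \<beta> \<gamma> x"
    by (auto simp: eventually_at)
  show ?thesis
  proof
    show "d / 2 > 0" "c / 2 > 0" using d c by auto
    show "c / 2 \<le> le_roy_neg \<alpha> \<beta> \<gamma> x" if "0 \<le> x" "x \<le> d / 2" for x
      using d(2)[of x] that d(1) c \<open>le_roy_neg \<alpha> \<beta> \<gamma> 0 = c\<close> by (cases "x = 0") (auto simp: less_imp_le)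
  qed
qed

lemma le_roy_raise_iterated_nonneg:
  assumes "\<beta> > 0" "\<And>x. x > 0 \<Longrightarrow> le_roy_neg \<alpha> \<beta> \<gamma> x \<ge> 0" "x > 0"
  shows "le_roy_neg \<alpha> (\<beta> + real j) \<gamma> x \<ge> 0"
  using assms(3)
proof (induction j arbitrary: x)
  case (Suc j)
  have "le_roy_neg \<alpha> (\<beta> + real j + 1) \<gamma> x \<ge> 0"
    using Suc assms(1) by (intro le_roy_raise_nonneg[OF pos] add_pos_nonneg) auto
  then show ?case by (simp add: add_ac)
qed (use assms in simp)

text \<open>The first step uses \<open>L = s\<close>, so that the integral sees the function near \<open>0\<close>, where it is bounded
  below, and creates the decay \<open>s^(\<gamma> - 1) exp (-s \<beta>/\<alpha>)\<close> at \<open>x0 exp s\<close>. The further steps use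
  \<open>L = 1\<close> and only lose constants, as \<open>s - t\<close> stays between \<open>s / 2\<close> and \<open>s\<close> for \<open>t \<in> [1, 2]\<close>.\<close>

lemma le_roy_raise_iterated_lower_bound:
  assumes \<beta>: "\<beta> > 0" and nonneg: "\<And>x. x > 0 \<Longrightarrow> le_roy_neg \<alpha> \<beta> \<gamma> x \<ge> 0"
  obtains x0 where "x0 > 0"
    "\<And>j. \<exists>K>0. \<exists>S\<ge>1. \<forall>s\<ge>S. K * s powr (\<gamma> - 1) * exp (- (\<beta> / \<alpha>) * s)
         \<le> le_roy_neg \<alpha> (\<beta> + real (Suc j)) \<gamma> (x0 * exp s)"
proof -
  obtain x0 c0 where x0: "x0 > 0" "c0 > 0" and low: "\<And>x. \<lbrakk>0 \<le> x; x \<le> x0\<rbrakk> \<Longrightarrow> c0 \<le> le_roy_neg \<alpha> \<beta> \<gamma> x"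
    using le_roy_lower_bound_near_0[OF \<beta>] by blast
  have "\<exists>K>0. \<exists>S\<ge>1. \<forall>s\<ge>S. K * s powr (\<gamma> - 1) * exp (- (\<beta> / \<alpha>) * s)
         \<le> le_roy_neg \<alpha> (\<beta> + real (Suc j)) \<gamma> (x0 * exp s)" for j
  proof (induction j)
    case 0
    obtain K where K: "K > 0"
      "\<And>x L m. \<lbrakk>x > 0; L \<ge> 1; m \<ge> 0; \<And>x. x > 0 \<Longrightarrow> le_roy_neg \<alpha> \<beta> \<gamma> x \<ge> 0;
       \<And>t. L \<le> t \<Longrightarrow> t \<le> L + 1 \<Longrightarrow> le_roy_neg \<alpha> \<beta> \<gamma> (x * exp (- t)) \<ge> m\<rbrakk>
      \<Longrightarrow> K * m * L powr (\<gamma> - 1) * exp (- (\<beta> / \<alpha>) * L) \<le> le_roy_neg \<alpha> (\<beta> + 1) \<gamma> x"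
      using le_roy_raise_lower_bound[OF pos \<beta>] by blast
    have "K * c0 * s powr (\<gamma> - 1) * exp (- (\<beta> / \<alpha>) * s) \<le> le_roy_neg \<alpha> (\<beta> + 1) \<gamma> (x0 * exp s)"
      if "s \<ge> 1" for s
    proof (rule K(2))
      show "c0 \<le> le_roy_neg \<alpha> \<beta> \<gamma> (x0 * exp s * exp (- t))" if "s \<le> t" for t
      proof (rule low)
        have "x0 * exp s * exp (- t) = x0 * exp (s - t)" by (simp add: exp_diff exp_minus divide_inverse)
        then show "x0 * exp s * exp (- t) \<le> x0" using x0 that by (simp add: mult_left_le)
      qed (use x0 in simp)
    qed (use that x0 nonneg in auto)
    then show ?case using K(1) x0 by (intro exI[of _ "K * c0"] conjI exI[of _ 1] allI impI) auto
  next
    case (Suc j)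
    define \<beta>' where "\<beta>' = \<beta> + real (Suc j)"
    have \<beta>': "\<beta>' > 0" using \<beta> by (simp add: \<beta>'_def)
    have nonneg': "le_roy_neg \<alpha> \<beta>' \<gamma> x \<ge> 0" if "x > 0" for x
      unfolding \<beta>'_def using le_roy_raise_iterated_nonneg[OF \<beta> nonneg that] by blast
    obtain K S where K: "K > 0" "S \<ge> 1" and KS: "\<And>s. s \<ge> S \<Longrightarrow>
        K * s powr (\<gamma> - 1) * exp (- (\<beta> / \<alpha>) * s) \<le> le_roy_neg \<alpha> \<beta>' \<gamma> (x0 * exp s)"
      using Suc unfolding \<beta>'_def by blast
    obtain K' where K': "K' > 0"
      "\<And>x L m. \<lbrakk>x > 0; L \<ge> 1; m \<ge> 0; \<And>x. x > 0 \<Longrightarrow> le_roy_neg \<alpha> \<beta>' \<gamma> x \<ge> 0;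
       \<And>t. L \<le> t \<Longrightarrow> t \<le> L + 1 \<Longrightarrow> le_roy_neg \<alpha> \<beta>' \<gamma> (x * exp (- t)) \<ge> m\<rbrakk>
      \<Longrightarrow> K' * m * L powr (\<gamma> - 1) * exp (- (\<beta>' / \<alpha>) * L) \<le> le_roy_neg \<alpha> (\<beta>' + 1) \<gamma> x"
      using le_roy_raise_lower_bound[OF pos \<beta>'] by blast
    define q where "q = min 1 (2 powr (\<gamma> - 1))"
    have q: "q > 0" by (simp add: q_def)
    define C where "C = K' * (K * (q / 2 powr (\<gamma> - 1))) * exp (- (\<beta>' / \<alpha>))"
    have C: "C > 0" using K(1) K'(1) q by (simp add: C_def)
    have "C * s powr (\<gamma> - 1) * exp (- (\<beta> / \<alpha>) * s) \<le> le_roy_neg \<alpha> (\<beta>' + 1) \<gamma> (x0 * exp s)"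
      if s: "s \<ge> max 4 (S + 2)" for s
    proof -
      define m where "m = K * (q * (s / 2) powr (\<gamma> - 1)) * exp (- (\<beta> / \<alpha>) * s)"
      have "K' * m * 1 powr (\<gamma> - 1) * exp (- (\<beta>' / \<alpha>) * 1) \<le> le_roy_neg \<alpha> (\<beta>' + 1) \<gamma> (x0 * exp s)"
      proof (rule K'(2))
        show "m \<le> le_roy_neg \<alpha> \<beta>' \<gamma> (x0 * exp s * exp (- t))" if t: "1 \<le> t" "t \<le> 1 + 1" for t
        proof -
          have "q * (s / 2) powr (\<gamma> - 1) \<le> (s - t) powr (\<gamma> - 1)"
            unfolding q_def using s t by (intro powr_lower_bound) auto
          moreover have "exp (- (\<beta> / \<alpha>) * s) \<le> exp (- (\<beta> / \<alpha>) * (s - t))"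
            using pos \<beta> t by (simp add: divide_right_mono mult_left_mono)
          ultimately have "m \<le> K * (s - t) powr (\<gamma> - 1) * exp (- (\<beta> / \<alpha>) * (s - t))"
            unfolding m_def using K q by (intro mult_mono mult_left_mono) auto
          also have "\<dots> \<le> le_roy_neg \<alpha> \<beta>' \<gamma> (x0 * exp (s - t))"
            using s t by (intro KS) auto
          also have "x0 * exp (s - t) = x0 * exp s * exp (- t)"
            by (simp add: exp_diff exp_minus divide_inverse)
          finally show ?thesis .
        qed
        show "m \<ge> 0" using K q by (simp add: m_def)
      qed (use x0 nonneg' in auto)
      moreover have "K' * m * 1 powr (\<gamma> - 1) * exp (- (\<beta>' / \<alpha>) * 1) =
          C * s powr (\<gamma> - 1) * exp (- (\<beta> / \<alpha>) * s)"
        using s by (simp add: m_def C_def powr_divide)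
      ultimately show ?thesis by simp
    qed
    moreover have "\<beta>' + 1 = \<beta> + real (Suc (Suc j))" by (simp add: \<beta>'_def)
    ultimately show ?case
      using C by (intro exI[of _ C] conjI exI[of _ "max 4 (S + 2)"] allI impI) auto
  qed
  then show ?thesis using that x0(1) by blast
qed

lemma le_roy_nonneg_imp_beta:
  assumes \<beta>: "\<beta> > 0" and nonneg: "\<And>x. x > 0 \<Longrightarrow> le_roy_neg \<alpha> \<beta> \<gamma> x \<ge> 0" and "\<alpha> * \<gamma> \<le> 1"
  shows "\<beta> > \<alpha> \<or> \<beta> = \<alpha> \<and> \<gamma> \<le> 1"
proof (rule ccontr)
  assume contra: "\<not> ?thesis"
  obtain x0 where x0: "x0 > 0" and low:
    "\<And>j. \<exists>K>0. \<exists>S\<ge>1. \<forall>s\<ge>S. K * s powr (\<gamma> - 1) * exp (- (\<beta> / \<alpha>) * s)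
         \<le> le_roy_neg \<alpha> (\<beta> + real (Suc j)) \<gamma> (x0 * exp s)"
    using le_roy_raise_iterated_lower_bound[OF \<beta> nonneg] by blast
  \<comment> \<open>So large that the function with second parameter \<open>B - \<alpha>\<close> is completely monotone.\<close>
  obtain j :: nat where j: "real j > 2 * \<alpha> + \<alpha> * (1 + \<gamma>) / 2"
    using reals_Archimedean2 by blast
  define B where "B = \<beta> + real (Suc j)"
  have "\<alpha> * (1 + \<gamma>) / 2 > 0" using pos by simp
  then have B: "B - \<alpha> \<ge> (if \<gamma> \<le> 1 then \<alpha> else \<alpha> * (1 + \<gamma>) / 2)" "B > \<alpha>"
    unfolding B_def of_nat_Suc using j \<beta> pos(1) by (simp only: split: if_split; linarith)+
  define C where "C = 1 / Gamma (B - \<alpha>) powr \<gamma>"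
  have upper: "x * le_roy_neg \<alpha> B \<gamma> x \<le> C" if "x > 0" for x
  proof -
    have "completely_monotone (le_roy_neg \<alpha> (B - \<alpha>) \<gamma>)"
      using B pos assms(3) by (intro completely_monotone_le_roy) auto
    then have "(-1) ^ 0 * (deriv ^^ 0) (le_roy_neg \<alpha> (B - \<alpha>) \<gamma>) x \<ge> 0"
      using that unfolding completely_monotone_def by blast
    then show ?thesis using le_roy_lower_index[OF B(2), of x] by (simp add: C_def)
  qed
  obtain K S where K: "K > 0" "S \<ge> 1" and KS: "\<And>s. s \<ge> S \<Longrightarrow>
      K * s powr (\<gamma> - 1) * exp (- (\<beta> / \<alpha>) * s) \<le> le_roy_neg \<alpha> B \<gamma> (x0 * exp s)"
    using low[of j] unfolding B_def by blast
  have bound: "s powr (\<gamma> - 1) * exp ((1 - \<beta> / \<alpha>) * s) \<le> C / (x0 * K)" if "s \<ge> S" for s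
  proof -
    have "exp ((1 - \<beta> / \<alpha>) * s) = exp s * exp (- (\<beta> / \<alpha>) * s)"
      by (simp add: algebra_simps flip: exp_add)
    then have "x0 * K * (s powr (\<gamma> - 1) * exp ((1 - \<beta> / \<alpha>) * s)) =
        x0 * exp s * (K * s powr (\<gamma> - 1) * exp (- (\<beta> / \<alpha>) * s))"
      by (simp only: mult_ac)
    also have "\<dots> \<le> x0 * exp s * le_roy_neg \<alpha> B \<gamma> (x0 * exp s)"
      using KS[OF that] x0 by (intro mult_left_mono) auto
    also have "\<dots> \<le> C" using upper[of "x0 * exp s"] x0 by simp
    finally show ?thesis using x0 K(1) by (simp add: field_simps)
  qed
  have "filterlim (\<lambda>s. s powr (\<gamma> - 1) * exp ((1 - \<beta> / \<alpha>) * s)) at_top at_top"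
  proof (cases "\<beta> = \<alpha>")
    case True
    then have "\<gamma> - 1 > 0" using contra by auto
    then have "filterlim (\<lambda>s. s powr (\<gamma> - 1)) at_top at_top" by real_asymp
    then show ?thesis using True pos by simp
  next
    case False
    then have "1 - \<beta> / \<alpha> > 0" using contra pos by (auto simp: field_simps)
    moreover have "filterlim (\<lambda>s. s powr p * exp (a * s)) at_top at_top" if "a > 0" for a p :: real
      using that by real_asymp
    ultimately show ?thesis by blast
  qed
  then have "eventually (\<lambda>s. s powr (\<gamma> - 1) * exp ((1 - \<beta> / \<alpha>) * s) > C / (x0 * K) \<and> s \<ge> S) at_top"
    by (intro eventually_conj eventually_ge_at_top) (simp add: filterlim_at_top_dense)
  then obtain s where "s powr (\<gamma> - 1) * exp ((1 - \<beta> / \<alpha>) * s) > C / (x0 * K)" "s \<ge> S"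
    by (auto simp: eventually_at_top_linorder)
  with bound[of s] show False by linarith
qed

end

section \<open>Parameter ranges of complete monotonicity\<close>

theorem mainTheorem1:
  fixes \<alpha> \<beta> \<gamma> :: real
  assumes "\<alpha> > 0" and "\<beta> > 0" and "\<gamma> > 0"
  shows
    "(\<gamma> \<le> 1 \<longrightarrow>
        (completely_monotone (le_roy_neg \<alpha> \<beta> \<gamma>) \<longleftrightarrow> \<alpha> * \<gamma> \<le> 1 \<and> \<beta> \<ge> \<alpha>)) \<and>
     (\<gamma> > 1 \<and> \<alpha> * \<gamma> \<noteq> 1 \<longrightarrow>
        (\<alpha> * \<gamma> < 1 \<and> \<beta> \<ge> \<alpha> * (1 + \<gamma>) / 2 \<longrightarrow> completely_monotone (le_roy_neg \<alpha> \<beta> \<gamma>)) \<and>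
        (\<alpha> * \<gamma> > 1 \<or> \<beta> \<le> \<alpha> \<longrightarrow> \<not> completely_monotone (le_roy_neg \<alpha> \<beta> \<gamma>))) \<and>
     (\<gamma> > 1 \<and> \<alpha> * \<gamma> = 1 \<longrightarrow>
        (completely_monotone (le_roy_neg \<alpha> \<beta> \<gamma>) \<longleftrightarrow> \<beta> \<ge> (1 + \<alpha>) / 2))"
proof -
  let ?CM = "completely_monotone (le_roy_neg \<alpha> \<beta> \<gamma>)"
  have suff: ?CM if "\<alpha> * \<gamma> \<le> 1" "\<beta> \<ge> (if \<gamma> \<le> 1 then \<alpha> else \<alpha> * (1 + \<gamma>) / 2)"
    using completely_monotone_le_roy[OF assms that] .
  have nec1: "\<alpha> * \<gamma> \<le> 1" if ?CM
    using alpha_gamma_le_1[OF assms that] .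
  have nec2: "\<beta> > \<alpha> \<or> \<beta> = \<alpha> \<and> \<gamma> \<le> 1" if ?CM
  proof (rule le_roy_nonneg_imp_beta[OF assms(1,3,2) _ nec1[OF that]])
    show "le_roy_neg \<alpha> \<beta> \<gamma> x \<ge> 0" if "x > 0" for x
      using \<open>?CM\<close> that unfolding completely_monotone_def by (metis funpow_0 mult_1 power_0)
  qed
  have nec3: "\<beta> \<ge> (1 + \<alpha>) / 2" if ?CM "\<alpha> * \<gamma> = 1"
    using beta_ge_critical[OF assms that] .
  have "\<alpha> * (1 + \<gamma>) / 2 = (1 + \<alpha>) / 2" if "\<alpha> * \<gamma> = 1"
    using that by (simp add: distrib_left)
  then show ?thesis
    using suff nec1 nec2 nec3 by (auto simp: not_le split: if_splits)
qed

end
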